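(* Let $\mathscr{A}$ be a finite alphabet, $\Omega=\mathscr{A}^{\mathbb{N}}$, and let $f:\Omega\to\mathbb{R}$ be a continuous potential. Then $\mathcal{G}^{DLR}(f)=\mathcal{G}^{TL}(f)$.
   Context: $\mathbb{N}=\{1,2,\dots\}$; $\Omega=\mathscr{A}^{\mathbb{N}}$ carries the metric $d(x,y)=2^{-N}$, $N=\inf\{i: x_i\neq y_i\}$ (with $d(x,x)=0$), and Borel $\sigma$-algebra $\mathscr{F}$; $\sigma:\Omega\to\Omega$ is the left shift; $C(\Omega)$ is the space of real continuous functions on $\Omega$; $\mathcal{P}(\Omega)$ is the set of Borel probability measures on $\Omega$. Kernels: for $f\in C(\Omega)$ and $n\in\mathbb{N}$ put $H_n(x)=f(x)+f(\sigma x)+\dots+f(\sigma^{n-1}x)$ and, for $F\in\mathscr{F}$, $y\in\Omega$, $$K_n(F,y)=\frac{1}{Z_n^y}\sum_{x\in\Omega:\ \sigma^n(x)=\sigma^n(y)}1_F(x)\exp(H_n(x)),\qquad Z_n^y=\sum_{x\in\Omega:\ \sigma^n(x)=\sigma^n(y)}\exp(H_n(x)).$$ Each $K_n(\cdot,y)$ is a Borel probability measure. DLR-Gibbs measures: let $\mathcal{T}_n$ be the $\sigma$-algebra generated by the coordinate projections $\pi_j:\Omega\to\mathscr{A}$, $j\ge n+1$. Then $\mathcal{G}^{DLR}(f)$ is the set of $\mu\in\mathcal{P}(\Omega)$ such that for all $F\in\mathscr{F}$ and all $n\in\mathbb{N}$, $\mu(F|\mathcal{T}_n)(y)=K_n(F,y)$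 for $\mu$-almost every $y$. Thermodynamic limits: for $y\in\Omega$ let $\mathscr{C}_y$ be the set of all cluster points, in the weak-$*$ topology, of $(K_n(\cdot,y))_{n\ge1}$, i.e. the weak-$*$ limits of its subsequences. $\mathcal{G}^{TL}(f)$ is the weak-$*$ closure of the convex hull of $\bigcup_{y\in\Omega}\mathscr{C}_y$. *)

theory Defs
  imports "HOL-Probability.Probability"
begin

section \<open>The one-sided full shift\<close>

text \<open>
  A point \<open>(x\<^sub>1, x\<^sub>2, \<dots>)\<close> of the sequence space over the alphabet \<open>'a\<close> is encoded as a
  function \<open>x :: nat \<Rightarrow> 'a\<close> whose value \<open>x i\<close> is the coordinate number \<open>i + 1\<close>.  Hence the exponent
  below is \<open>N = inf {i \<ge> 1. x\<^sub>i \<noteq> y\<^sub>i}\<close>, and the coordinates \<open>j \<ge> n + 1\<close> are the arguments \<open>i \<ge> n\<close>.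
\<close>

definition seq_dist :: "(nat \<Rightarrow> 'a) \<Rightarrow> (nat \<Rightarrow> 'a) \<Rightarrow> real" where
  "seq_dist x y = (if x = y then 0 else (1/2) ^ Suc (LEAST i. x i \<noteq> y i))"

definition seq_top :: "(nat \<Rightarrow> 'a) topology" where
  "seq_top = Metric_space.mtopology UNIV seq_dist"

definition seq_borel :: "(nat \<Rightarrow> 'a) measure" where
  "seq_borel = sigma UNIV {U. openin seq_top U}"

definition seq_shift :: "(nat \<Rightarrow> 'a) \<Rightarrow> (nat \<Rightarrow> 'a)" where
  "seq_shift x = (\<lambda>i. x (Suc i))"

definition Cont :: "((nat \<Rightarrow> 'a) \<Rightarrow> real) set" where
  "Cont = {g. continuous_map seq_top euclideanreal g}"

definition Prob :: "(nat \<Rightarrow> 'a) measure set" where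
  "Prob = {\<mu>. sets \<mu> = sets seq_borel \<and> prob_space \<mu>}"


section \<open>Kernels\<close>

definition birkhoff :: "((nat \<Rightarrow> 'a) \<Rightarrow> real) \<Rightarrow> nat \<Rightarrow> (nat \<Rightarrow> 'a) \<Rightarrow> real" where
  "birkhoff f n x = (\<Sum>i<n. f ((seq_shift ^^ i) x))"

definition partition_fun :: "((nat \<Rightarrow> 'a) \<Rightarrow> real) \<Rightarrow> nat \<Rightarrow> (nat \<Rightarrow> 'a) \<Rightarrow> real" where
  "partition_fun f n y = (\<Sum>x | (seq_shift ^^ n) x = (seq_shift ^^ n) y. exp (birkhoff f n x))"

definition kern :: "((nat \<Rightarrow> 'a) \<Rightarrow> real) \<Rightarrow> nat \<Rightarrow> (nat \<Rightarrow> 'a) set \<Rightarrow> (nat \<Rightarrow> 'a) \<Rightarrow> real" where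
  "kern f n F y =
     (1 / partition_fun f n y) *
     (\<Sum>x | (seq_shift ^^ n) x = (seq_shift ^^ n) y. indicator F x * exp (birkhoff f n x))"

text \<open>
  The set function \<open>F \<mapsto> kern f n F y\<close> as an element of the type of measures; the lemmas
  \<open>emeasure_kern_measure\<close> and \<open>kern_measure_in_Prob\<close> below show that this is the intended object.
\<close>

definition kern_measure ::
  "((nat \<Rightarrow> 'a) \<Rightarrow> real) \<Rightarrow> nat \<Rightarrow> (nat \<Rightarrow> 'a) \<Rightarrow> (nat \<Rightarrow> 'a) measure" where
  "kern_measure f n y = measure_of UNIV (sets seq_borel) (\<lambda>F. ennreal (kern f n F y))"


section \<open>DLR-Gibbs measures\<close>

definition tail_algebra :: "nat \<Rightarrow> (nat \<Rightarrow> 'a) measure" where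
  "tail_algebra n = sigma UNIV {(\<lambda>x. x i) -` A | i A. n \<le> i}"

definition G_DLR :: "((nat \<Rightarrow> 'a) \<Rightarrow> real) \<Rightarrow> (nat \<Rightarrow> 'a) measure set" where
  "G_DLR f = {\<mu> \<in> Prob. \<forall>F \<in> sets seq_borel. \<forall>n\<ge>1.
      AE y in \<mu>. real_cond_exp \<mu> (tail_algebra n) (indicator F) y = kern f n F y}"


section \<open>Thermodynamic limits\<close>

text \<open>
  The weak-* topology on \<open>Prob\<close>: the coarsest one making \<open>\<mu> \<mapsto> \<integral>x. g x \<partial>\<mu>\<close> continuous
  for every continuous \<open>g\<close>.
\<close>

definition weak_star :: "(nat \<Rightarrow> 'a) measure topology" where
  "weak_star = topology_generated_by
     {{\<mu> \<in> Prob. (\<integral>x. g x \<partial>\<mu>) \<in> U} | g U. g \<in> Cont \<and> open U}"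

definition cluster_points :: "((nat \<Rightarrow> 'a) \<Rightarrow> real) \<Rightarrow> (nat \<Rightarrow> 'a) \<Rightarrow> (nat \<Rightarrow> 'a) measure set" where
  "cluster_points f y = {\<mu>. \<exists>r :: nat \<Rightarrow> nat. strict_mono r \<and> (\<forall>k. 1 \<le> r k) \<and>
      limitin weak_star (\<lambda>k. kern_measure f (r k) y) \<mu> sequentially}"

text \<open>
  The type of measures is not a real vector space, so finite convex combinations are taken
  setwise.
\<close>

definition measure_convex_hull :: "(nat \<Rightarrow> 'a) measure set \<Rightarrow> (nat \<Rightarrow> 'a) measure set" where
  "measure_convex_hull S = {\<mu> \<in> Prob. \<exists>T w. finite T \<and> T \<subseteq> S \<and>
      (\<forall>\<nu>\<in>T. 0 \<le> w \<nu>) \<and> (\<Sum>\<nu>\<in>T. w \<nu>) = (1::real) \<and>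
      (\<forall>F \<in> sets seq_borel. measure \<mu> F = (\<Sum>\<nu>\<in>T. w \<nu> * measure \<nu> F))}"

definition G_TL :: "((nat \<Rightarrow> 'a) \<Rightarrow> real) \<Rightarrow> (nat \<Rightarrow> 'a) measure set" where
  "G_TL f = weak_star closure_of (measure_convex_hull (\<Union>y. cluster_points f y))"


section \<open>Well-definedness of the notions above\<close>

lemma seq_dist_ge:
  assumes "x i \<noteq> y i"
  shows "(1/2) ^ Suc i \<le> seq_dist x y"
proof -
  have "x \<noteq> y" using assms by blast
  moreover have "(LEAST i. x i \<noteq> y i) \<le> i" using assms by (rule Least_le)
  ultimately show ?thesis
    by (simp add: seq_dist_def power_decreasing)
qed

lemma seq_dist_eqI: "seq_dist x y < (1/2) ^ Suc i \<Longrightarrow> x i = y i"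
  using seq_dist_ge[of x i y] linorder_not_less by blast

lemma Metric_space_seq: "Metric_space UNIV seq_dist"
proof
  show "0 \<le> seq_dist x y" for x y :: "nat \<Rightarrow> 'a"
    by (simp add: seq_dist_def)
  show "seq_dist x y = seq_dist y x" for x y :: "nat \<Rightarrow> 'a"
    by (simp add: seq_dist_def eq_commute)
  show "seq_dist x y = 0 \<longleftrightarrow> x = y" for x y :: "nat \<Rightarrow> 'a"
    by (simp add: seq_dist_def)
  show "seq_dist x z \<le> seq_dist x y + seq_dist y z" for x y z :: "nat \<Rightarrow> 'a"
  proof (cases "x = z")
    case True
    then show ?thesis by (simp add: seq_dist_def)
  next
    case False
    define k where "k = (LEAST i. x i \<noteq> z i)"
    have "\<exists>i. x i \<noteq> z i" using False by auto
    then have "x k \<noteq> z k" unfolding k_def by (rule LeastI_ex)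
    then have "x k \<noteq> y k \<or> y k \<noteq> z k" by auto
    then have "(1/2) ^ Suc k \<le> seq_dist x y \<or> (1/2) ^ Suc k \<le> seq_dist y z"
      using seq_dist_ge by blast
    moreover have "seq_dist x z = (1/2) ^ Suc k"
      using False by (simp add: seq_dist_def k_def)
    moreover have "0 \<le> seq_dist x y" "0 \<le> seq_dist y z"
      by (simp_all add: seq_dist_def)
    ultimately show ?thesis by linarith
  qed
qed

lemma topspace_seq_top [simp]: "topspace seq_top = UNIV"
  by (simp add: seq_top_def Metric_space.topspace_mtopology[OF Metric_space_seq])

lemma openin_seq_top_coord: "openin seq_top ((\<lambda>x. x i) -` A)"
  unfolding seq_top_def Metric_space.openin_mtopology[OF Metric_space_seq]
proof (intro conjI allI impI)
  fix x :: "nat \<Rightarrow> 'a" assume x: "x \<in> (\<lambda>x. x i) -` A"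
  show "\<exists>r>0. Metric_space.mball UNIV seq_dist x r \<subseteq> (\<lambda>x. x i) -` A"
  proof (intro exI conjI subsetI)
    fix y assume "y \<in> Metric_space.mball UNIV seq_dist x ((1/2) ^ Suc i)"
    then have "seq_dist x y < (1/2) ^ Suc i"
      by (simp add: Metric_space.in_mball[OF Metric_space_seq])
    from seq_dist_eqI[OF this] x show "y \<in> (\<lambda>x. x i) -` A" by simp
  qed simp
qed simp

lemma space_seq_borel [simp]: "space seq_borel = UNIV"
  by (simp add: seq_borel_def space_measure_of_conv)

lemma sets_seq_borel: "sets seq_borel = sigma_sets UNIV {U. openin seq_top U}"
  by (simp add: seq_borel_def)

lemma subalgebra_tail_algebra:
  assumes "\<mu> \<in> Prob"
  shows "subalgebra \<mu> (tail_algebra n)"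
proof -
  have sets: "sets \<mu> = sets seq_borel" using assms by (simp add: Prob_def)
  have "sigma_sets UNIV {(\<lambda>x. x i) -` A | i A. n \<le> i} \<subseteq> sigma_sets UNIV {U. openin seq_top U}"
    by (rule sigma_sets_mono') (auto simp: openin_seq_top_coord)
  then show ?thesis
    using sets sets_eq_imp_space_eq[OF sets]
    by (simp add: subalgebra_def tail_algebra_def sets_seq_borel space_measure_of_conv)
qed

lemma topspace_weak_star [simp]: "topspace weak_star = Prob"
proof -
  have "(\<lambda>_. 0) \<in> Cont" by (simp add: Cont_def)
  then have "Prob \<in> {{\<mu> \<in> Prob. (\<integral>x. g x \<partial>\<mu>) \<in> U} | g U. g \<in> Cont \<and> open U}"
    by (intro CollectI exI[of _ "\<lambda>_. 0"] exI[of _ UNIV]) simp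
  then have "Prob \<subseteq> topspace weak_star"
    unfolding weak_star_def topology_generated_by_topspace by (rule Union_upper)
  moreover have "topspace weak_star \<subseteq> Prob"
    unfolding weak_star_def topology_generated_by_topspace by (rule Union_least) auto
  ultimately show ?thesis by (rule subset_antisym[rotated])
qed

lemma seq_shift_funpow: "(seq_shift ^^ n) x = (\<lambda>i. x (i + n))"
  by (induction n) (auto simp: seq_shift_def)

lemma finite_fiber:
  fixes y :: "nat \<Rightarrow> 'a::finite"
  shows "finite {x. (seq_shift ^^ n) x = (seq_shift ^^ n) y}"
proof (rule finite_subset)
  let ?ext = "\<lambda>g i. if i < n then g i else y i"
  show "{x. (seq_shift ^^ n) x = (seq_shift ^^ n) y} \<subseteq> ?ext ` (PiE {..<n} (\<lambda>_. UNIV))"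
  proof
    fix x assume "x \<in> {x. (seq_shift ^^ n) x = (seq_shift ^^ n) y}"
    then have "(\<lambda>i. x (i + n)) = (\<lambda>i. y (i + n))"
      by (simp only: mem_Collect_eq seq_shift_funpow)
    then have eq: "x (i + n) = y (i + n)" for i
      by (rule fun_cong)
    have "x i = y i" if "\<not> i < n" for i
      using eq[of "i - n"] that by simp
    then have "x = ?ext (restrict x {..<n})" by (intro ext) simp
    moreover have "restrict x {..<n} \<in> PiE {..<n} (\<lambda>_. UNIV)" by simp
    ultimately show "x \<in> ?ext ` (PiE {..<n} (\<lambda>_. UNIV))" by (rule image_eqI)
  qed
  show "finite (?ext ` (PiE {..<n} (\<lambda>_. UNIV :: 'a set)))"
    by (intro finite_imageI finite_PiE) auto
qed

lemma partition_fun_pos: "0 < partition_fun f n (y :: nat \<Rightarrow> 'a::finite)"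
  unfolding partition_fun_def
  by (rule sum_pos) (auto simp: finite_fiber)

lemma emeasure_kern_measure:
  fixes y :: "nat \<Rightarrow> 'a::finite"
  assumes "F \<in> sets seq_borel"
  shows "emeasure (kern_measure f n y) F = ennreal (kern f n F y)"
proof -
  define S where "S = {x. (seq_shift ^^ n) x = (seq_shift ^^ n) y}"
  define c where "c x = exp (birkhoff f n x) / partition_fun f n y" for x
  define M where "M = distr (point_measure S (\<lambda>x. ennreal (c x))) seq_borel (\<lambda>x. x)"
  have fin: "finite S" unfolding S_def by (rule finite_fiber)
  have c: "0 \<le> c x" for x
    using partition_fun_pos[of f n y] by (simp add: c_def)
  have M: "emeasure M A = ennreal (kern f n A y)" if "A \<in> sets seq_borel" for A
  proof -
    have "emeasure M A = emeasure (point_measure S (\<lambda>x. ennreal (c x))) (A \<inter> S)"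
      unfolding M_def using that
      by (subst emeasure_distr) (auto simp: measurable_point_measure_eq1 space_point_measure)
    also have "\<dots> = (\<Sum>x\<in>A \<inter> S. ennreal (c x))"
      using fin by (intro emeasure_point_measure_finite) auto
    also have "\<dots> = ennreal (\<Sum>x\<in>A \<inter> S. c x)"
      using c by (intro sum_ennreal) auto
    also have "(\<Sum>x\<in>A \<inter> S. c x) = (\<Sum>x\<in>S. indicator A x * c x)"
      using fin by (intro sum.mono_neutral_cong_left) (auto simp: indicator_def)
    also have "\<dots> = kern f n A y"
      unfolding kern_def S_def c_def by (simp add: sum_distrib_left)
    finally show ?thesis .
  qed
  have "countably_additive (sets seq_borel) (emeasure M)"
    using emeasure_countably_additive[of M] by (simp add: M_def)
  then have "countably_additive (sets seq_borel) (\<lambda>F. ennreal (kern f n F y))"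
    unfolding countably_additive_def using M by (auto simp: subset_eq)
  then have "emeasure (measure_of UNIV (sets seq_borel) (\<lambda>F. ennreal (kern f n F y))) F =
             ennreal (kern f n F y)"
    using assms sets.sigma_algebra_axioms[of seq_borel]
    by (intro emeasure_measure_of_sigma) (auto simp: positive_def kern_def)
  then show ?thesis by (simp add: kern_measure_def)
qed

lemma kern_measure_in_Prob: "kern_measure f n (y :: nat \<Rightarrow> 'a::finite) \<in> Prob"
proof -
  have sp: "space (kern_measure f n y) = UNIV"
    by (simp add: kern_measure_def space_measure_of_conv)
  have "kern f n UNIV y = 1"
    using partition_fun_pos[of f n y] by (simp add: kern_def partition_fun_def)
  moreover have "UNIV \<in> sets seq_borel"
    using sets.top[of seq_borel] by simp
  ultimately have "prob_space (kern_measure f n y)"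
    using emeasure_kern_measure[of UNIV f n y] by (intro prob_spaceI) (simp add: sp)
  moreover have "sets (kern_measure f n y) = sets seq_borel"
    using sets.sigma_sets_eq[of seq_borel] sets.space_closed[of seq_borel]
    by (simp add: kern_measure_def sets_measure_of_conv)
  ultimately show ?thesis by (simp add: Prob_def)
qed

end

theory Submission
  imports Defs "HOL-Library.Diagonal_Subsequence"
begin

text \<open>
  Both sets consist of the probability measures that are invariant under all the kernels \<open>K\<^sub>n\<close>.

  A measure \<open>\<mu>\<close> is DLR-Gibbs if and only if \<open>\<integral>K\<^sub>n 1\<^sub>A d\<mu> = \<mu>(A)\<close> for all \<open>n \<ge> 1\<close> and all cylinders \<open>A\<close>
  (\<open>G_DLR_eq_kern_invariant\<close>).  Invariance follows by integrating the conditional expectation; for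
  the converse, invariance extends from cylinders to Borel sets, and \<open>K\<^sub>n\<close> lets events of the tail
  algebra pass through as factors, which is the defining property of the conditional expectation.

  Since \<open>f\<close> is continuous, \<open>K\<^sub>n 1\<^sub>A\<close> is continuous, so invariance is a weak-* closed and convex
  condition.  The consistency \<open>K\<^sub>r K\<^sub>n = K\<^sub>r\<close> for \<open>n \<le> r\<close> (\<open>kern_op_consistent\<close>) passes to the limit
  \<open>r \<rightarrow> \<infinity>\<close>: all cluster points of \<open>K\<^sub>r(\<cdot>, y)\<close> are invariant.  Hence thermodynamic limits are
  DLR-Gibbs.

  For the other inclusion let \<open>\<mu>\<close> be invariant.  No continuous function \<open>h\<close> separates \<open>\<mu>\<close> from the
  cluster points: the functions \<open>K\<^sub>n h\<close> all have \<open>\<mu>\<close>-integral \<open>\<integral>h d\<mu>\<close>, so at some boundary condition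
  \<open>y\<close> their upper limit is not essentially smaller, and by sequential compactness of the probability
  measures this upper limit is nearly attained by a cluster point
  (\<open>ex_cluster_point_integral_ge\<close>).  A basic weak-* neighbourhood of \<open>\<mu>\<close> involves only finitely many
  continuous functions.  A finite-dimensional separation argument (\<open>convex_combination_approx\<close>),
  applied to the vectors of integrals of these functions, therefore yields a convex combination of
  cluster points in the neighbourhood.
\<close>

section \<open>Cylinders and compactness of the shift space\<close>

definition agree :: "nat \<Rightarrow> (nat \<Rightarrow> 'a) \<Rightarrow> (nat \<Rightarrow> 'a) \<Rightarrow> bool" where
  "agree n x y \<longleftrightarrow> (\<forall>i<n. x i = y i)"

text \<open>
  All sets determined by finitely many coordinates, and not only those given by a single word:
  they form an algebra, to which the extension theorem for measures applies.
\<close>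

definition cylinder_sets :: "(nat \<Rightarrow> 'a) set set" where
  "cylinder_sets = {A. \<exists>n. \<forall>x y. agree n x y \<longrightarrow> x \<in> A \<longrightarrow> y \<in> A}"

text \<open>
  The words of length \<open>n\<close>, as functions that are \<open>undefined\<close> from \<open>n\<close> on: being sequences
  themselves, they also serve as the sample points of the cylinders that they define.
\<close>

definition words :: "nat \<Rightarrow> (nat \<Rightarrow> 'a) set" where
  "words n = PiE {..<n} (\<lambda>_. UNIV)"

definition concat_at :: "nat \<Rightarrow> (nat \<Rightarrow> 'a) \<Rightarrow> (nat \<Rightarrow> 'a) \<Rightarrow> nat \<Rightarrow> 'a" where
  "concat_at n w y = (\<lambda>i. if i < n then w i else y i)"

lemma agree_refl [simp]: "agree n x x"
  by (simp add: agree_def)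

lemma agree_sym: "agree n x y \<Longrightarrow> agree n y x"
  by (simp add: agree_def)

lemma agree_trans: "agree n x y \<Longrightarrow> agree n y z \<Longrightarrow> agree n x z"
  by (simp add: agree_def)

lemma agree_mono: "agree n x y \<Longrightarrow> m \<le> n \<Longrightarrow> agree m x y"
  by (simp add: agree_def)

lemma finite_words [simp]: "finite (words n :: (nat \<Rightarrow> 'a::finite) set)"
  unfolding words_def by (intro finite_PiE) auto

lemma restrict_in_words: "restrict x {..<n} \<in> words n"
  by (simp add: words_def)

lemma agree_restrict: "agree n (restrict x {..<n}) x"
  by (simp add: agree_def)

lemma words_agree_eq:
  assumes "v \<in> words n" "w \<in> words n" "agree n v w"
  shows "v = w"
  using assms unfolding words_def agree_def by (intro PiE_ext) auto

lemma agree_word_iff: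
  assumes "w \<in> words n"
  shows "agree n w x \<longleftrightarrow> w = restrict x {..<n}"
  using assms words_agree_eq[OF assms restrict_in_words] agree_restrict agree_sym agree_trans
  by metis

lemma agree_iff_seq_dist: "seq_dist x y < (1/2) ^ n \<longleftrightarrow> agree n x y"
proof
  assume *: "seq_dist x y < (1/2) ^ n"
  show "agree n x y" unfolding agree_def
  proof (intro allI impI)
    fix i assume "i < n"
    then have "(1/2::real) ^ n \<le> (1/2) ^ Suc i" by (intro power_decreasing) auto
    with * show "x i = y i" by (intro seq_dist_eqI) simp
  qed
next
  assume *: "agree n x y"
  show "seq_dist x y < (1/2) ^ n"
  proof (cases "x = y")
    case False
    then obtain j where "x j \<noteq> y j" by auto
    then have "x (LEAST i. x i \<noteq> y i) \<noteq> y (LEAST i. x i \<noteq> y i)" by (rule LeastI)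
    then have "n \<le> (LEAST i. x i \<noteq> y i)" using * unfolding agree_def by (meson not_le)
    then have "(1/2::real) ^ Suc (LEAST i. x i \<noteq> y i) < (1/2) ^ n"
      by (intro power_strict_decreasing) auto
    then show ?thesis using False by (simp add: seq_dist_def)
  qed (simp add: seq_dist_def)
qed

lemma openin_seq_top_iff:
  "openin seq_top U \<longleftrightarrow> (\<forall>x\<in>U. \<exists>n. \<forall>y. agree n x y \<longrightarrow> y \<in> U)"
proof -
  have "(\<exists>r>0. Metric_space.mball UNIV seq_dist x r \<subseteq> U) \<longleftrightarrow> (\<exists>n. \<forall>y. agree n x y \<longrightarrow> y \<in> U)" for x
  proof
    assume "\<exists>r>0. Metric_space.mball UNIV seq_dist x r \<subseteq> U"
    then obtain r where r: "r > 0" "Metric_space.mball UNIV seq_dist x r \<subseteq> U" by auto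
    obtain n where "(1/2) ^ n < r"
      using real_arch_pow_inv[OF r(1), of "1/2"] by auto
    then have "\<forall>y. agree n x y \<longrightarrow> y \<in> U"
      using r(2) by (auto simp: agree_iff_seq_dist[symmetric] Metric_space.mball_def[OF Metric_space_seq])
    then show "\<exists>n. \<forall>y. agree n x y \<longrightarrow> y \<in> U" ..
  next
    assume "\<exists>n. \<forall>y. agree n x y \<longrightarrow> y \<in> U"
    then obtain n where "\<forall>y. agree n x y \<longrightarrow> y \<in> U" ..
    then show "\<exists>r>0. Metric_space.mball UNIV seq_dist x r \<subseteq> U"
      by (intro exI[of _ "(1/2) ^ n"])
         (auto simp: agree_iff_seq_dist Metric_space.mball_def[OF Metric_space_seq])
  qed
  then show ?thesis
    by (simp add: seq_top_def Metric_space.openin_mtopology[OF Metric_space_seq] Ball_def)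
qed

lemma continuous_map_seq_top_iff:
  fixes h :: "(nat \<Rightarrow> 'a) \<Rightarrow> nat \<Rightarrow> 'b"
  shows "continuous_map seq_top seq_top h \<longleftrightarrow>
     (\<forall>x n. \<exists>m. \<forall>y. agree m x y \<longrightarrow> agree n (h x) (h y))"
proof
  assume h: "continuous_map seq_top seq_top h"
  show "\<forall>x n. \<exists>m. \<forall>y. agree m x y \<longrightarrow> agree n (h x) (h y)"
  proof (intro allI)
    fix x n
    have "openin seq_top {z. agree n (h x) z}"
      unfolding openin_seq_top_iff using agree_trans by blast
    then have "openin seq_top {y. agree n (h x) (h y)}"
      using openin_continuous_map_preimage[OF h, of "{z. agree n (h x) z}"] by simp
    then show "\<exists>m. \<forall>y. agree m x y \<longrightarrow> agree n (h x) (h y)"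
      unfolding openin_seq_top_iff by auto
  qed
next
  assume h: "\<forall>x n. \<exists>m. \<forall>y. agree m x y \<longrightarrow> agree n (h x) (h y)"
  show "continuous_map seq_top seq_top h"
    unfolding continuous_map_def
  proof (intro conjI allI impI)
    fix U :: "(nat \<Rightarrow> 'b) set" assume "openin seq_top U"
    then show "openin seq_top {x \<in> topspace seq_top. h x \<in> U}"
      using h unfolding openin_seq_top_iff topspace_seq_top by (metis UNIV_I mem_Collect_eq)
  qed simp
qed

lemma Cont_iff:
  "h \<in> Cont \<longleftrightarrow> (\<forall>x. \<forall>e>0. \<exists>n. \<forall>y. agree n x y \<longrightarrow> \<bar>h y - h x\<bar> < e)"
proof
  assume "h \<in> Cont"
  then have h: "continuous_map seq_top euclideanreal h" by (simp add: Cont_def)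
  show "\<forall>x. \<forall>e>0. \<exists>n. \<forall>y. agree n x y \<longrightarrow> \<bar>h y - h x\<bar> < e"
  proof (intro allI impI)
    fix x and e :: real assume "0 < e"
    moreover have "openin seq_top {y. h y \<in> ball (h x) e}"
      using openin_continuous_map_preimage[OF h, of "ball (h x) e"] by simp
    ultimately show "\<exists>n. \<forall>y. agree n x y \<longrightarrow> \<bar>h y - h x\<bar> < e"
      unfolding openin_seq_top_iff by (auto simp: dist_real_def abs_minus_commute)
  qed
next
  assume h: "\<forall>x. \<forall>e>0. \<exists>n. \<forall>y. agree n x y \<longrightarrow> \<bar>h y - h x\<bar> < e"
  have "openin seq_top {x. h x \<in> U}" if U: "open U" for U
    unfolding openin_seq_top_iff
  proof
    fix x assume "x \<in> {x. h x \<in> U}"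
    then obtain e where "e > 0" "\<And>z. \<bar>z - h x\<bar> < e \<Longrightarrow> z \<in> U"
      using U by (auto simp: open_dist dist_real_def)
    with h show "\<exists>n. \<forall>y. agree n x y \<longrightarrow> y \<in> {x. h x \<in> U}" by (metis mem_Collect_eq)
  qed
  then show "h \<in> Cont" by (simp add: Cont_def continuous_map_def)
qed

lemma Cont_compose: "h \<in> Cont \<Longrightarrow> continuous_map seq_top seq_top \<phi> \<Longrightarrow> (\<lambda>x. h (\<phi> x)) \<in> Cont"
  using continuous_map_compose[of seq_top seq_top \<phi> euclideanreal h]
  by (simp add: Cont_def o_def)

lemma Cont_sum:
  "(\<And>i. i \<in> I \<Longrightarrow> h i \<in> Cont) \<Longrightarrow> (\<lambda>x. \<Sum>i\<in>I. h i x) \<in> Cont"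
  by (cases "finite I") (auto simp: Cont_def intro!: continuous_map_sum)

lemma Cont_const [simp]: "(\<lambda>_. c) \<in> Cont"
  by (simp add: Cont_def)

lemma Cont_mult: "g \<in> Cont \<Longrightarrow> h \<in> Cont \<Longrightarrow> (\<lambda>x. g x * h x) \<in> Cont"
  by (auto simp: Cont_def intro!: continuous_map_real_mult)

lemma Cont_diff: "g \<in> Cont \<Longrightarrow> h \<in> Cont \<Longrightarrow> (\<lambda>x. g x - h x) \<in> Cont"
  by (auto simp: Cont_def intro!: continuous_map_diff)

lemma Cont_divide:
  "g \<in> Cont \<Longrightarrow> h \<in> Cont \<Longrightarrow> (\<And>x. h x \<noteq> 0) \<Longrightarrow> (\<lambda>x. g x / h x) \<in> Cont"
  by (auto simp: Cont_def intro!: continuous_map_real_divide)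

lemma Cont_exp: "h \<in> Cont \<Longrightarrow> (\<lambda>x. exp (h x)) \<in> Cont"
  using continuous_map_compose[of seq_top euclideanreal h euclideanreal exp]
  by (simp add: Cont_def o_def continuous_on_exp continuous_on_id)

lemma Cont_indicator_cylinder: "A \<in> cylinder_sets \<Longrightarrow> indicator A \<in> Cont"
  unfolding Cont_iff cylinder_sets_def
  by (smt (verit, best) agree_sym indicator_simps(1,2) mem_Collect_eq)

lemma continuous_map_shift: "continuous_map seq_top seq_top (seq_shift ^^ n)"
  unfolding continuous_map_seq_top_iff seq_shift_funpow agree_def
  by (metis add_less_cancel_right)

lemma continuous_map_concat_at: "continuous_map seq_top seq_top (concat_at n w)"
  unfolding continuous_map_seq_top_iff concat_at_def agree_def by metis

text \<open>
  Over a finite alphabet every coordinate is constant along a subsequence; diagonalising over the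
  coordinates gives sequential compactness of the shift space.
\<close>

lemma pointwise_convergent_subseq:
  fixes x :: "nat \<Rightarrow> nat \<Rightarrow> 'a::finite"
  obtains d z where "strict_mono d" "\<And>n. \<forall>\<^sub>F k in sequentially. agree n z (x (d k))"
proof -
  define P where "P i s \<longleftrightarrow> (\<exists>a. \<forall>k. x (s k) i = a)" for i and s :: "nat \<Rightarrow> nat"
  interpret subseqs P
  proof
    fix i and s :: "nat \<Rightarrow> nat" assume "strict_mono s"
    have "\<exists>a. infinite {k \<in> UNIV. x (s k) i = a}"
      using pigeonhole_infinite_rel[of "UNIV :: nat set" "UNIV :: 'a set" "\<lambda>k a. x (s k) i = a"]
      by auto
    then obtain a where a: "infinite {k. x (s k) i = a}" by auto
    then have "P i (s \<circ> enumerate {k. x (s k) i = a})"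
      using enumerate_in_set[OF a] by (auto simp: P_def)
    with a show "\<exists>r. strict_mono r \<and> P i (s \<circ> r)"
      using strict_mono_enumerate by blast
  qed
  have stable: "P i (s \<circ> r)" if "strict_mono r" "P i s" for i r s
    using that by (auto simp: P_def)
  have "\<exists>a. \<forall>\<^sub>F k in sequentially. x (diagseq k) i = a" for i
  proof -
    have "P i (diagseq \<circ> ((+) (Suc i)))" by (rule diagseq_holds) (use stable in blast)
    then obtain a where a: "\<And>k. x (diagseq (Suc i + k)) i = a" by (auto simp: P_def)
    then have "x (diagseq k) i = a" if "k \<ge> Suc i" for k
      using a[of "k - Suc i"] that by simp
    then show ?thesis unfolding eventually_sequentially by blast
  qed
  then obtain z where z: "\<And>i. \<forall>\<^sub>F k in sequentially. x (diagseq k) i = z i" by metis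
  have "\<forall>\<^sub>F k in sequentially. agree n z (x (diagseq k))" for n
  proof -
    have "\<forall>\<^sub>F k in sequentially. \<forall>i\<in>{..<n}. x (diagseq k) i = z i"
      using z by (intro eventually_ball_finite) auto
    then show ?thesis by (rule eventually_mono) (auto simp: agree_def)
  qed
  with subseq_diagseq that show thesis by blast
qed

lemma uniformly_continuous_Cont:
  fixes h :: "(nat \<Rightarrow> 'a::finite) \<Rightarrow> real"
  assumes h: "h \<in> Cont" and "e > 0"
  obtains n where "\<And>x y. agree n x y \<Longrightarrow> \<bar>h x - h y\<bar> < e"
proof (rule ccontr)
  assume "\<not> thesis"
  with that have "\<forall>n. \<exists>x y. agree n x y \<and> \<not> \<bar>h x - h y\<bar> < e" by blast
  then obtain x y where xy: "\<And>n. agree n (x n) (y n)" "\<And>n. \<not> \<bar>h (x n) - h (y n)\<bar> < e" by metis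
  obtain d z where d: "strict_mono d" "\<And>n. \<forall>\<^sub>F k in sequentially. agree n z (x (d k))"
    using pointwise_convergent_subseq[of x] by blast
  obtain n where n: "\<And>w. agree n z w \<Longrightarrow> \<bar>h w - h z\<bar> < e / 2"
    using h \<open>e > 0\<close> unfolding Cont_iff by (meson half_gt_zero)
  have "\<forall>\<^sub>F k in sequentially. agree n z (x (d k)) \<and> n \<le> k"
    using d(2) eventually_ge_at_top by (rule eventually_conj)
  then obtain k where k: "agree n z (x (d k))" "n \<le> k"
    by (auto dest: eventually_happens)
  moreover have "n \<le> d k" using seq_suble[OF d(1)] k(2) le_trans by blast
  then have "agree n z (y (d k))" using xy(1) k(1) agree_mono agree_trans by blast
  ultimately have "\<bar>h (x (d k)) - h z\<bar> < e / 2" "\<bar>h (y (d k)) - h z\<bar> < e / 2"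
    using n by auto
  then show False using xy(2)[of "d k"] by linarith
qed

lemma bounded_Cont:
  fixes h :: "(nat \<Rightarrow> 'a::finite) \<Rightarrow> real"
  assumes "h \<in> Cont"
  obtains B where "0 \<le> B" "\<And>x. \<bar>h x\<bar> \<le> B"
proof -
  obtain n where n: "\<And>x y. agree n x y \<Longrightarrow> \<bar>h x - h y\<bar> < 1"
    using uniformly_continuous_Cont[OF assms, of 1] by auto
  define B where "B = (\<Sum>w\<in>words n. \<bar>h w\<bar>) + 1"
  have "\<bar>h x\<bar> \<le> B" for x
  proof -
    have "\<bar>h (restrict x {..<n})\<bar> \<le> (\<Sum>w\<in>words n. \<bar>h w\<bar>)"
      by (rule member_le_sum[OF restrict_in_words]) auto
    with n[OF agree_restrict[of n x]] show ?thesis unfolding B_def by linarith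
  qed
  moreover have "0 \<le> B" unfolding B_def by (simp add: sum_nonneg)
  ultimately show thesis using that by blast
qed


section \<open>Cylinders generate the Borel sets\<close>

lemma cylinder_of_word: "{x. agree n w x} \<in> cylinder_sets"
  unfolding cylinder_sets_def using agree_trans by blast

lemma UNIV_cylinder: "UNIV \<in> cylinder_sets"
  by (auto simp: cylinder_sets_def)

lemma algebra_cylinder_sets: "algebra UNIV cylinder_sets"
  unfolding algebra_iff_Un
proof (intro conjI ballI)
  show "{} \<in> cylinder_sets" by (auto simp: cylinder_sets_def)
next
  fix A :: "(nat \<Rightarrow> 'a) set" assume "A \<in> cylinder_sets"
  then show "UNIV - A \<in> cylinder_sets"
    unfolding cylinder_sets_def using agree_sym by blast
next
  fix A B :: "(nat \<Rightarrow> 'a) set" assume "A \<in> cylinder_sets" "B \<in> cylinder_sets"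
  then obtain m n where mn: "\<And>x y. agree m x y \<Longrightarrow> x \<in> A \<Longrightarrow> y \<in> A"
      "\<And>x y. agree n x y \<Longrightarrow> x \<in> B \<Longrightarrow> y \<in> B"
    unfolding cylinder_sets_def by blast
  have "agree m x y" "agree n x y" if "agree (max m n) x y" for x y :: "nat \<Rightarrow> 'a"
    using that by (auto simp: agree_def)
  with mn show "A \<union> B \<in> cylinder_sets" unfolding cylinder_sets_def by blast
qed simp

lemma Int_stable_cylinder_sets: "Int_stable cylinder_sets"
proof -
  interpret algebra UNIV cylinder_sets by (rule algebra_cylinder_sets)
  show ?thesis by (auto simp: Int_stable_def)
qed

lemma countable_cylinder_sets: "countable (cylinder_sets :: (nat \<Rightarrow> 'a::finite) set set)"
proof -
  have "(cylinder_sets :: (nat \<Rightarrow> 'a) set set)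
      \<subseteq> (\<Union>n. (\<lambda>W. {x. restrict x {..<n} \<in> W}) ` Pow (words n))"
  proof
    fix A :: "(nat \<Rightarrow> 'a) set" assume "A \<in> cylinder_sets"
    then obtain n where n: "\<And>x y. agree n x y \<Longrightarrow> x \<in> A \<Longrightarrow> y \<in> A"
      unfolding cylinder_sets_def by blast
    have "A = {x. restrict x {..<n} \<in> A \<inter> words n}"
      using n agree_restrict agree_sym restrict_in_words by blast
    then show "A \<in> (\<Union>n. (\<lambda>W. {x. restrict x {..<n} \<in> W}) ` Pow (words n))"
      by blast
  qed
  moreover have "countable (\<Union>n. (\<lambda>W. {x. restrict x {..<n} \<in> W}) ` Pow (words n :: (nat \<Rightarrow> 'a) set))"
    by (intro countable_UN countable_image) (auto intro: countable_finite)
  ultimately show ?thesis by (rule countable_subset)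
qed

lemma sets_seq_borel_cylinder:
  "sets (seq_borel :: (nat \<Rightarrow> 'a::finite) measure) = sigma_sets UNIV cylinder_sets"
proof
  have "openin seq_top A" if "A \<in> cylinder_sets" for A :: "(nat \<Rightarrow> 'a) set"
    using that unfolding openin_seq_top_iff cylinder_sets_def by blast
  then show "sigma_sets UNIV cylinder_sets \<subseteq> sets (seq_borel :: (nat \<Rightarrow> 'a) measure)"
    unfolding sets_seq_borel by (intro sigma_sets_mono') auto
next
  interpret sigma_algebra UNIV "sigma_sets UNIV (cylinder_sets :: (nat \<Rightarrow> 'a) set set)"
    by (rule sigma_algebra_sigma_sets) simp
  have "U \<in> sigma_sets UNIV cylinder_sets" if "openin seq_top U" for U :: "(nat \<Rightarrow> 'a) set"
  proof -
    have "U = \<Union> {A \<in> cylinder_sets. A \<subseteq> U}"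
    proof
      show "U \<subseteq> \<Union> {A \<in> cylinder_sets. A \<subseteq> U}"
      proof
        fix x assume "x \<in> U"
        then obtain n where "\<forall>y. agree n x y \<longrightarrow> y \<in> U"
          using \<open>openin seq_top U\<close> unfolding openin_seq_top_iff by blast
        then have "{y. agree n x y} \<in> {A \<in> cylinder_sets. A \<subseteq> U}"
          using cylinder_of_word by blast
        then show "x \<in> \<Union> {A \<in> cylinder_sets. A \<subseteq> U}"
          by (rule UnionI) simp
      qed
    qed blast
    moreover have "\<Union> {A \<in> cylinder_sets. A \<subseteq> U} \<in> sigma_sets UNIV cylinder_sets"
      by (rule countable_Union)
         (auto intro: countable_subset[OF _ countable_cylinder_sets] sigma_sets.Basic)
    ultimately show ?thesis by simp
  qed
  then show "sets (seq_borel :: (nat \<Rightarrow> 'a) measure) \<subseteq> sigma_sets UNIV cylinder_sets"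
    unfolding sets_seq_borel by (intro sigma_sets_mono) auto
qed

lemma cylinder_borel: "A \<in> cylinder_sets \<Longrightarrow> A \<in> sets (seq_borel :: (nat \<Rightarrow> 'a::finite) measure)"
  by (simp add: sets_seq_borel_cylinder sigma_sets.Basic)

lemma Prob_sets: "\<nu> \<in> Prob \<Longrightarrow> sets \<nu> = sets seq_borel"
  by (simp add: Prob_def)

lemma Prob_space: "\<nu> \<in> Prob \<Longrightarrow> space \<nu> = UNIV"
  using sets_eq_imp_space_eq[of \<nu> seq_borel] by (simp add: Prob_def)

lemma Prob_prob_space: "\<nu> \<in> Prob \<Longrightarrow> prob_space \<nu>"
  by (simp add: Prob_def)

lemma Cont_borel: "h \<in> Cont \<Longrightarrow> h \<in> borel_measurable seq_borel"
proof (rule borel_measurableI)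
  fix S :: "real set" assume h: "h \<in> Cont" and "open S"
  then have "openin seq_top {x \<in> topspace seq_top. h x \<in> S}"
    by (intro openin_continuous_map_preimage[of _ euclideanreal]) (auto simp: Cont_def)
  then show "h -` S \<inter> space seq_borel \<in> sets seq_borel"
    by (auto simp: sets_seq_borel vimage_def intro: sigma_sets.Basic)
qed

lemma Cont_measurable: "h \<in> Cont \<Longrightarrow> \<nu> \<in> Prob \<Longrightarrow> h \<in> borel_measurable \<nu>"
  using Cont_borel measurable_cong_sets[OF Prob_sets refl] by blast

lemma Cont_integrable:
  fixes h :: "(nat \<Rightarrow> 'a::finite) \<Rightarrow> real"
  assumes "h \<in> Cont" "\<nu> \<in> Prob"
  shows "integrable \<nu> h"
proof -
  interpret prob_space \<nu> using assms by (simp add: Prob_def)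
  obtain B where "\<And>x. \<bar>h x\<bar> \<le> B" using bounded_Cont[OF assms(1)] by blast
  then show ?thesis
    using Cont_measurable[OF assms] by (intro integrable_const_bound[of _ B]) auto
qed

lemma abs_integral_Cont_le:
  fixes g :: "(nat \<Rightarrow> 'a::finite) \<Rightarrow> real"
  assumes g: "g \<in> Cont"
  shows "\<exists>B. \<forall>\<nu>\<in>Prob. \<bar>\<integral>x. g x \<partial>\<nu>\<bar> \<le> B"
proof -
  obtain B where B: "\<And>x. \<bar>g x\<bar> \<le> B" using bounded_Cont[OF g] by blast
  have "\<bar>\<integral>x. g x \<partial>\<nu>\<bar> \<le> B" if "\<nu> \<in> Prob" for \<nu>
  proof -
    interpret prob_space \<nu> using that by (rule Prob_prob_space)
    have "(\<integral>x. \<bar>g x\<bar> \<partial>\<nu>) \<le> B"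
      using Cont_integrable[OF g that] B by (intro integral_le_const) auto
    then show ?thesis using integral_abs_bound[of \<nu> g] by linarith
  qed
  then show ?thesis by blast
qed

text \<open>
  Uniform continuity makes the integral of a continuous function a uniform limit, over all
  probability measures at once, of finite linear combinations of cylinder probabilities.  All
  statements about integrals of continuous functions are reduced to cylinders in this way.
\<close>

lemma integral_approx_cylinders:
  fixes h :: "(nat \<Rightarrow> 'a::finite) \<Rightarrow> real"
  assumes h: "h \<in> Cont" and e: "e > 0"
  obtains n where
    "\<And>\<nu>. \<nu> \<in> Prob \<Longrightarrow> \<bar>(\<integral>x. h x \<partial>\<nu>) - (\<Sum>w\<in>words n. h w * measure \<nu> {x. agree n w x})\<bar> \<le> e"
proof -
  obtain n where n: "\<And>x y. agree n x y \<Longrightarrow> \<bar>h x - h y\<bar> < e"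
    using uniformly_continuous_Cont[OF assms] by blast
  have "\<bar>(\<integral>x. h x \<partial>\<nu>) - (\<Sum>w\<in>words n. h w * measure \<nu> {x. agree n w x})\<bar> \<le> e"
    if \<nu>: "\<nu> \<in> Prob" for \<nu>
  proof -
    interpret prob_space \<nu> using \<nu> by (rule Prob_prob_space)
    define g where "g x = (\<Sum>w\<in>words n. h w * indicator {x. agree n w x} x)" for x
    have cyl: "{x. agree n w x} \<in> sets \<nu>" for w :: "nat \<Rightarrow> 'a"
      using cylinder_borel[OF cylinder_of_word] Prob_sets[OF \<nu>] by simp
    have g: "g x = h (restrict x {..<n})" for x
    proof -
      have "g x = (\<Sum>w\<in>words n. if w = restrict x {..<n} then h w else 0)"
        unfolding g_def by (intro sum.cong) (auto simp: agree_word_iff indicator_def)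
      then show ?thesis by (simp add: restrict_in_words)
    qed
    have ind: "integrable \<nu> (\<lambda>x. h w * indicator {x. agree n w x} x)" for w
      using cyl[of w] by (auto intro!: integrable_mult_right simp: emeasure_finite less_top[symmetric])
    have "integrable \<nu> g" unfolding g_def using ind by (intro Bochner_Integration.integrable_sum) auto
    moreover have "integral\<^sup>L \<nu> g = (\<Sum>w\<in>words n. h w * measure \<nu> {x. agree n w x})"
      unfolding g_def using ind cyl Prob_space[OF \<nu>]
      by (subst Bochner_Integration.integral_sum) auto
    ultimately have "(\<integral>x. h x \<partial>\<nu>) - (\<Sum>w\<in>words n. h w * measure \<nu> {x. agree n w x})
        = (\<integral>x. h x - g x \<partial>\<nu>)"
      using Cont_integrable[OF h \<nu>] by simp
    moreover have "\<bar>\<integral>x. h x - g x \<partial>\<nu>\<bar> \<le> (\<integral>x. \<bar>h x - g x\<bar> \<partial>\<nu>)"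
      by (rule integral_abs_bound)
    moreover have "\<bar>h x - g x\<bar> \<le> e" for x
      using n[OF agree_sym[OF agree_restrict[of n x]]] by (simp add: g)
    then have "(\<integral>x. \<bar>h x - g x\<bar> \<partial>\<nu>) \<le> e"
      using Cont_integrable[OF h \<nu>] \<open>integrable \<nu> g\<close>
      by (intro integral_le_const) auto
    ultimately show ?thesis by linarith
  qed
  with that show thesis by blast
qed

section \<open>Weak-* convergence and compactness\<close>

text \<open>
  Convergence and closure in the weak-* topology only ever involve finitely many integrals at a time
  and one common error bound.
\<close>

lemma weak_star_nbhd:
  fixes \<mu> :: "(nat \<Rightarrow> 'a) measure"
  assumes "openin weak_star U" "\<mu> \<in> U"
  shows "\<exists>G e. finite G \<and> G \<subseteq> Cont \<and> e > 0 \<and>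
    (\<forall>\<nu>\<in>Prob. (\<forall>g\<in>G. \<bar>(\<integral>x. g x \<partial>\<nu>) - (\<integral>x. g x \<partial>\<mu>)\<bar> < e) \<longrightarrow> \<nu> \<in> U)"
    (is "?nbhd U")
proof -
  from assms(1) have "generate_topology_on
      {{\<mu> \<in> Prob. (\<integral>x. g x \<partial>\<mu>) \<in> V} | g V. g \<in> Cont \<and> open V} U"
    unfolding weak_star_def by (rule openin_topology_generated_by)
  then show ?thesis using assms(2)
  proof induction
    case (Int a b)
    then have "\<mu> \<in> a" "\<mu> \<in> b" by auto
    from Int.IH(1)[OF this(1)] obtain G e where G: "finite G" "G \<subseteq> Cont" "e > 0"
      "\<forall>\<nu>\<in>Prob. (\<forall>g\<in>G. \<bar>(\<integral>x. g x \<partial>\<nu>) - (\<integral>x. g x \<partial>\<mu>)\<bar> < e) \<longrightarrow> \<nu> \<in> a"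
      by (elim exE conjE)
    from Int.IH(2)[OF \<open>\<mu> \<in> b\<close>] obtain G' e' where G': "finite G'" "G' \<subseteq> Cont" "e' > 0"
      "\<forall>\<nu>\<in>Prob. (\<forall>g\<in>G'. \<bar>(\<integral>x. g x \<partial>\<nu>) - (\<integral>x. g x \<partial>\<mu>)\<bar> < e') \<longrightarrow> \<nu> \<in> b"
      by (elim exE conjE)
    show ?case
    proof (intro exI conjI ballI impI)
      show "finite (G \<union> G')" "G \<union> G' \<subseteq> Cont" "min e e' > 0"
        using G(1-3) G'(1-3) by auto
      fix \<nu> :: "(nat \<Rightarrow> 'a) measure" assume "\<nu> \<in> Prob"
        and close: "\<forall>g\<in>G \<union> G'. \<bar>(\<integral>x. g x \<partial>\<nu>) - (\<integral>x. g x \<partial>\<mu>)\<bar> < min e e'"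
      from close have "\<forall>g\<in>G. \<bar>(\<integral>x. g x \<partial>\<nu>) - (\<integral>x. g x \<partial>\<mu>)\<bar> < e"
        "\<forall>g\<in>G'. \<bar>(\<integral>x. g x \<partial>\<nu>) - (\<integral>x. g x \<partial>\<mu>)\<bar> < e'"
        unfolding ball_Un min_less_iff_conj by blast+
      then show "\<nu> \<in> a \<inter> b" using G(4) G'(4) \<open>\<nu> \<in> Prob\<close> by blast
    qed
  next
    case (UN K)
    then obtain k where k: "k \<in> K" "\<mu> \<in> k" by auto
    from UN.IH[OF k] show ?case
    proof (elim exE conjE)
      fix G and e :: real
      assume "finite G" "G \<subseteq> Cont" "e > 0"
        "\<forall>\<nu>\<in>Prob. (\<forall>g\<in>G. \<bar>(\<integral>x. g x \<partial>\<nu>) - (\<integral>x. g x \<partial>\<mu>)\<bar> < e) \<longrightarrow> \<nu> \<in> k"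
      with k(1) show ?thesis by (intro exI[of _ G] exI[of _ e]) auto
    qed
  next
    case (Basis s)
    from Basis.hyps obtain g V where s: "s = {\<mu> \<in> Prob. (\<integral>x. g x \<partial>\<mu>) \<in> V}" "g \<in> Cont" "open V"
      by (elim CollectE exE conjE)
    with Basis.prems have "(\<integral>x. g x \<partial>\<mu>) \<in> V" by simp
    with \<open>open V\<close> obtain e where "e > 0" "\<And>r. \<bar>r - (\<integral>x. g x \<partial>\<mu>)\<bar> < e \<Longrightarrow> r \<in> V"
      unfolding open_dist dist_real_def by blast
    with s show ?case by (intro exI[of _ "{g}"] exI[of _ e]) auto
  qed simp
qed

lemma openin_weak_star_integral:
  assumes "g \<in> Cont" "open V"
  shows "openin weak_star {\<nu> \<in> Prob. (\<integral>x. g x \<partial>\<nu>) \<in> V}"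
  unfolding weak_star_def using assms by (intro topology_generated_by_Basis CollectI exI[of _ g] exI[of _ V]) simp

lemma limitin_weak_star_iff:
  fixes M :: "'b \<Rightarrow> (nat \<Rightarrow> 'a) measure"
  assumes "\<And>k. M k \<in> Prob"
  shows "limitin weak_star M \<mu> F \<longleftrightarrow>
    \<mu> \<in> Prob \<and> (\<forall>g\<in>Cont. ((\<lambda>k. \<integral>x. g x \<partial>M k) \<longlongrightarrow> (\<integral>x. g x \<partial>\<mu>)) F)"
proof (intro iffI conjI ballI)
  assume "limitin weak_star M \<mu> F"
  then show "\<mu> \<in> Prob" by (simp add: limitin_def)
next
  fix g :: "(nat \<Rightarrow> 'a) \<Rightarrow> real" assume lim: "limitin weak_star M \<mu> F" and g: "g \<in> Cont"
  show "((\<lambda>k. \<integral>x. g x \<partial>M k) \<longlongrightarrow> (\<integral>x. g x \<partial>\<mu>)) F"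
  proof (rule topological_tendstoI)
    fix V assume "open V" "(\<integral>x. g x \<partial>\<mu>) \<in> V"
    moreover have "\<mu> \<in> Prob" using lim by (simp add: limitin_def)
    moreover have "\<forall>U. openin weak_star U \<and> \<mu> \<in> U \<longrightarrow> (\<forall>\<^sub>F k in F. M k \<in> U)"
      using lim by (simp add: limitin_def)
    ultimately have "\<forall>\<^sub>F k in F. M k \<in> {\<nu> \<in> Prob. (\<integral>x. g x \<partial>\<nu>) \<in> V}"
      using openin_weak_star_integral[OF g, of V] by blast
    then show "\<forall>\<^sub>F k in F. (\<integral>x. g x \<partial>M k) \<in> V" by (rule eventually_mono) simp
  qed
next
  assume *: "\<mu> \<in> Prob \<and> (\<forall>g\<in>Cont. ((\<lambda>k. \<integral>x. g x \<partial>M k) \<longlongrightarrow> (\<integral>x. g x \<partial>\<mu>)) F)"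
  show "limitin weak_star M \<mu> F"
    unfolding limitin_def
  proof (intro conjI allI impI)
    show "\<mu> \<in> topspace weak_star" using * by simp
  next
    fix U :: "(nat \<Rightarrow> 'a) measure set" assume "openin weak_star U \<and> \<mu> \<in> U"
    then have "openin weak_star U" "\<mu> \<in> U" by auto
    from weak_star_nbhd[OF this] obtain G e where G: "finite G" "G \<subseteq> Cont" "e > 0"
        "\<forall>\<nu>\<in>Prob. (\<forall>g\<in>G. \<bar>(\<integral>x. g x \<partial>\<nu>) - (\<integral>x. g x \<partial>\<mu>)\<bar> < e) \<longrightarrow> \<nu> \<in> U"
      by (elim exE conjE)
    have "\<forall>\<^sub>F k in F. \<bar>(\<integral>x. g x \<partial>M k) - (\<integral>x. g x \<partial>\<mu>)\<bar> < e" if "g \<in> G" for g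
    proof -
      have "((\<lambda>k. \<integral>x. g x \<partial>M k) \<longlongrightarrow> (\<integral>x. g x \<partial>\<mu>)) F" using * G(2) that by blast
      from tendstoD[OF this G(3)] show ?thesis by (simp add: dist_real_def)
    qed
    with G(1) have "\<forall>\<^sub>F k in F. \<forall>g\<in>G. \<bar>(\<integral>x. g x \<partial>M k) - (\<integral>x. g x \<partial>\<mu>)\<bar> < e"
      by (intro eventually_ball_finite) blast+
    then show "\<forall>\<^sub>F k in F. M k \<in> U" by (rule eventually_mono) (use G(4) assms in blast)
  qed
qed

text \<open>
  The error of the cylinder approximation is the same for all measures, so it can be fixed before
  the limit of the finitely many cylinder probabilities is taken.
\<close>

lemma limitin_weak_star_cylinders:
  fixes \<mu> :: "(nat \<Rightarrow> 'a::finite) measure"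
  assumes M: "\<And>k. M k \<in> Prob" and \<mu>: "\<mu> \<in> Prob"
    and lim: "\<And>A. A \<in> cylinder_sets \<Longrightarrow> ((\<lambda>k. measure (M k) A) \<longlongrightarrow> measure \<mu> A) F"
  shows "limitin weak_star M \<mu> F"
  unfolding limitin_weak_star_iff[OF M]
proof (intro conjI ballI tendstoI)
  fix g :: "(nat \<Rightarrow> 'a) \<Rightarrow> real" and e :: real assume g: "g \<in> Cont" and "e > 0"
  obtain n where n: "\<And>\<nu>. \<nu> \<in> Prob \<Longrightarrow>
      \<bar>(\<integral>x. g x \<partial>\<nu>) - (\<Sum>w\<in>words n. g w * measure \<nu> {x. agree n w x})\<bar> \<le> e / 3"
    using integral_approx_cylinders[OF g, of "e / 3"] \<open>e > 0\<close> by auto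
  have "((\<lambda>k. \<Sum>w\<in>words n. g w * measure (M k) {x. agree n w x})
      \<longlongrightarrow> (\<Sum>w\<in>words n. g w * measure \<mu> {x. agree n w x})) F"
    by (intro tendsto_intros lim cylinder_of_word)
  from tendstoD[OF this, of "e / 3"] \<open>e > 0\<close>
  have "\<forall>\<^sub>F k in F. \<bar>(\<Sum>w\<in>words n. g w * measure (M k) {x. agree n w x}) -
      (\<Sum>w\<in>words n. g w * measure \<mu> {x. agree n w x})\<bar> < e / 3"
    by (simp add: dist_real_def)
  then show "\<forall>\<^sub>F k in F. dist (\<integral>x. g x \<partial>M k) (\<integral>x. g x \<partial>\<mu>) < e"
  proof (rule eventually_mono)
    fix k
    assume "\<bar>(\<Sum>w\<in>words n. g w * measure (M k) {x. agree n w x}) -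
      (\<Sum>w\<in>words n. g w * measure \<mu> {x. agree n w x})\<bar> < e / 3"
    with n[OF M, of k] n[OF \<mu>] show "dist (\<integral>x. g x \<partial>M k) (\<integral>x. g x \<partial>\<mu>) < e"
      unfolding dist_real_def by linarith
  qed
qed (rule \<mu>)

text \<open>
  Cylinder sets are compact, so a finitely additive set function on them is automatically
  continuous at the empty set.  This is what turns limits of cylinder probabilities into measures.
\<close>

lemma decseq_cylinders_empty:
  fixes A :: "nat \<Rightarrow> (nat \<Rightarrow> 'a::finite) set"
  assumes A: "\<And>i. A i \<in> cylinder_sets" "decseq A" "(\<Inter>i. A i) = {}"
  shows "\<exists>i. A i = {}"
proof (rule ccontr)
  assume "\<nexists>i. A i = {}"
  then have "\<forall>i. \<exists>x. x \<in> A i" by auto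
  then obtain x where x: "\<And>i. x i \<in> A i" by metis
  obtain d z where d: "strict_mono d" "\<And>n. \<forall>\<^sub>F k in sequentially. agree n z (x (d k))"
    using pointwise_convergent_subseq[of x] by blast
  have "z \<in> A i" for i
  proof -
    obtain n where n: "\<And>x y. agree n x y \<Longrightarrow> x \<in> A i \<Longrightarrow> y \<in> A i"
      using A(1)[of i] unfolding cylinder_sets_def by blast
    have "\<forall>\<^sub>F k in sequentially. agree n z (x (d k)) \<and> i \<le> k"
      using d(2) eventually_ge_at_top by (rule eventually_conj)
    then obtain k where k: "agree n z (x (d k))" "i \<le> k"
      by (auto dest: eventually_happens)
    have "i \<le> d k" using seq_suble[OF d(1)] k(2) le_trans by blast
    then have "x (d k) \<in> A i" using x[of "d k"] decseqD[OF A(2)] by blast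
    then show ?thesis using n k(1) agree_sym by blast
  qed
  then show False using A(3) by blast
qed

lemma Prob_of_cylinder_limits:
  fixes M :: "nat \<Rightarrow> (nat \<Rightarrow> 'a::finite) measure"
  assumes M: "\<And>k. M k \<in> Prob"
    and conv: "\<And>A. A \<in> cylinder_sets \<Longrightarrow> convergent (\<lambda>k. measure (M k) A)"
  obtains \<mu> where "\<mu> \<in> Prob"
    "\<And>A. A \<in> cylinder_sets \<Longrightarrow> (\<lambda>k. measure (M k) A) \<longlonglongrightarrow> measure \<mu> A"
proof -
  interpret algebra UNIV "cylinder_sets :: (nat \<Rightarrow> 'a) set set" by (rule algebra_cylinder_sets)
  define L where "L A = lim (\<lambda>k. measure (M k) A)" for A
  have L: "(\<lambda>k. measure (M k) A) \<longlonglongrightarrow> L A" if "A \<in> cylinder_sets" for A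
    using conv[OF that] unfolding L_def by (simp add: convergent_LIMSEQ_iff)
  have L_nonneg: "0 \<le> L A" if "A \<in> cylinder_sets" for A
    using L[OF that] by (rule LIMSEQ_le_const) auto
  have L_empty: "L {} = 0" by (simp add: L_def)
  have L_UNIV: "L UNIV = 1"
  proof -
    have "measure (M k) UNIV = 1" for k
      using prob_space.prob_space[OF Prob_prob_space[OF M]] Prob_space[OF M] by metis
    then show ?thesis by (simp add: L_def)
  qed
  have L_Un: "L (A \<union> B) = L A + L B"
    if AB: "A \<in> cylinder_sets" "B \<in> cylinder_sets" "A \<inter> B = {}" for A B
  proof -
    have "measure (M k) (A \<union> B) = measure (M k) A + measure (M k) B" for k
      using AB cylinder_borel Prob_sets[OF M] prob_space.finite_measure[OF Prob_prob_space[OF M]]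
      by (intro finite_measure.finite_measure_Union) auto
    then have "(\<lambda>k. measure (M k) (A \<union> B)) \<longlonglongrightarrow> L A + L B"
      using tendsto_add[OF L[OF AB(1)] L[OF AB(2)]] by simp
    moreover have "(\<lambda>k. measure (M k) (A \<union> B)) \<longlonglongrightarrow> L (A \<union> B)"
      using AB by (intro L) auto
    ultimately show ?thesis using LIMSEQ_unique by blast
  qed
  have "\<exists>m :: (nat \<Rightarrow> 'a) set \<Rightarrow> ennreal. (\<forall>s \<in> cylinder_sets. m s = ennreal (L s)) \<and>
      measure_space UNIV (sigma_sets UNIV cylinder_sets) m"
  proof (rule caratheodory_empty_continuous)
    show "positive cylinder_sets (\<lambda>A. ennreal (L A))" by (simp add: positive_def L_empty)
    show "additive cylinder_sets (\<lambda>A. ennreal (L A))"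
      by (auto simp: additive_def L_Un L_nonneg ennreal_plus)
    fix A :: "nat \<Rightarrow> (nat \<Rightarrow> 'a) set"
    assume A: "range A \<subseteq> cylinder_sets" "decseq A" "(\<Inter>i. A i) = {}"
    obtain i where i: "A i = {}" using decseq_cylinders_empty[of A] A by blast
    then have "A j = {}" if "j \<ge> i" for j using decseqD[OF A(2) that] by blast
    then have "\<forall>\<^sub>F j in sequentially. ennreal (L (A j)) = 0"
      unfolding eventually_sequentially by (auto simp: L_empty intro!: exI[of _ i])
    then show "(\<lambda>j. ennreal (L (A j))) \<longlonglongrightarrow> 0" by (rule tendsto_eventually)
  qed auto
  then obtain m :: "(nat \<Rightarrow> 'a) set \<Rightarrow> ennreal" where
    m: "\<And>A. A \<in> cylinder_sets \<Longrightarrow> m A = ennreal (L A)"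
      "measure_space UNIV (sigma_sets UNIV cylinder_sets) m" by blast
  define \<mu> where "\<mu> = measure_of UNIV cylinder_sets m"
  have sets_\<mu>: "sets \<mu> = sigma_sets UNIV cylinder_sets"
    by (simp add: \<mu>_def)
  then have sets: "sets \<mu> = sets seq_borel" by (simp add: sets_seq_borel_cylinder)
  have emeasure: "emeasure \<mu> A = ennreal (L A)" if "A \<in> cylinder_sets" for A
  proof -
    have "emeasure \<mu> A = m A"
      using m(2) that
      by (intro emeasure_measure_of[OF \<mu>_def])
         (auto simp: sets_\<mu> measure_space_def sigma_sets.Basic)
    then show ?thesis using m(1)[OF that] by simp
  qed
  have "space \<mu> = UNIV" by (simp add: \<mu>_def)
  then have "prob_space \<mu>" using emeasure[OF UNIV_cylinder] L_UNIV by (intro prob_spaceI) simp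
  with sets have "\<mu> \<in> Prob" by (simp add: Prob_def)
  moreover have "(\<lambda>k. measure (M k) A) \<longlonglongrightarrow> measure \<mu> A" if "A \<in> cylinder_sets" for A
    using L[OF that] emeasure[OF that] L_nonneg[OF that] by (simp add: measure_def)
  ultimately show thesis using that by blast
qed

text \<open>
  The cylinder algebra is countable, so a diagonal argument makes all cylinder probabilities
  converge along one subsequence.
\<close>

theorem Prob_weak_star_seq_compact:
  fixes M :: "nat \<Rightarrow> (nat \<Rightarrow> 'a::finite) measure"
  assumes M: "\<And>k. M k \<in> Prob"
  obtains d \<mu> where "strict_mono d" "limitin weak_star (\<lambda>k. M (d k)) \<mu> sequentially"
proof -
  define C :: "nat \<Rightarrow> (nat \<Rightarrow> 'a) set" where "C = from_nat_into cylinder_sets"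
  define P where "P i s \<longleftrightarrow> convergent (\<lambda>k. measure (M (s k)) (C i))" for i and s :: "nat \<Rightarrow> nat"
  interpret subseqs P
  proof
    fix i and s :: "nat \<Rightarrow> nat" assume "strict_mono s"
    have "\<forall>k. measure (M (s k)) (C i) \<in> {0..1}"
      using prob_space.prob_le_1[OF Prob_prob_space[OF M]] by simp
    then obtain l r where "strict_mono r" "((\<lambda>k. measure (M (s k)) (C i)) \<circ> r) \<longlonglongrightarrow> l"
      using compact_Icc[of "0::real" 1] unfolding compact_def by meson
    then show "\<exists>r. strict_mono r \<and> P i (s \<circ> r)"
      by (auto simp: P_def o_def convergent_def)
  qed
  have stable: "P i (s \<circ> r)" if "strict_mono r" "P i s" for i r s
    using convergent_subseq_convergent[OF that(2)[unfolded P_def] that(1)]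
    by (simp add: P_def o_def)
  have "convergent (\<lambda>k. measure (M (diagseq k)) A)" if A: "A \<in> cylinder_sets" for A
  proof -
    obtain i where i: "C i = A"
      using from_nat_into_surj[OF countable_cylinder_sets A] by (auto simp: C_def)
    have "P i (diagseq \<circ> ((+) (Suc i)))" by (rule diagseq_holds) (use stable in blast)
    then have "convergent (\<lambda>k. measure (M (diagseq (k + Suc i))) A)"
      by (simp add: P_def i o_def add.commute)
    then show ?thesis
      using convergent_ignore_initial_segment[of "\<lambda>k. measure (M (diagseq k)) A" "Suc i"] by simp
  qed
  from Prob_of_cylinder_limits[of "\<lambda>k. M (diagseq k)", OF M this] obtain \<mu> where
    "\<mu> \<in> Prob" "\<And>A. A \<in> cylinder_sets \<Longrightarrow> (\<lambda>k. measure (M (diagseq k)) A) \<longlonglongrightarrow> measure \<mu> A"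
    by blast
  then have "limitin weak_star (\<lambda>k. M (diagseq k)) \<mu> sequentially"
    by (intro limitin_weak_star_cylinders M)
  with subseq_diagseq show thesis by (rule that)
qed


section \<open>Convex combinations\<close>

lemma Prob_mixture:
  fixes T :: "(nat \<Rightarrow> 'a::finite) measure set"
  assumes T: "finite T" "T \<subseteq> Prob" and w: "\<And>\<nu>. \<nu> \<in> T \<Longrightarrow> 0 \<le> w \<nu>" "(\<Sum>\<nu>\<in>T. w \<nu>) = (1::real)"
  obtains \<mu> where "\<mu> \<in> Prob"
    "\<And>F. F \<in> sets seq_borel \<Longrightarrow> measure \<mu> F = (\<Sum>\<nu>\<in>T. w \<nu> * measure \<nu> F)"
proof -
  define m where "m F = (\<Sum>\<nu>\<in>T. ennreal (w \<nu>) * emeasure \<nu> F)" for F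
  define \<mu> where "\<mu> = measure_of UNIV (sets seq_borel) m"
  have sets: "sets \<mu> = sets seq_borel"
    using sets.sigma_sets_eq[of "seq_borel :: (nat \<Rightarrow> 'a) measure"]
      sets.space_closed[of "seq_borel :: (nat \<Rightarrow> 'a) measure"]
    by (simp add: \<mu>_def sets_measure_of_conv)
  have "countably_additive (sets seq_borel) m"
  proof (rule countably_additiveI)
    fix A :: "nat \<Rightarrow> (nat \<Rightarrow> 'a) set"
    assume A: "range A \<subseteq> sets seq_borel" "disjoint_family A"
    have "(\<Sum>i. m (A i)) = (\<Sum>\<nu>\<in>T. \<Sum>i. ennreal (w \<nu>) * emeasure \<nu> (A i))"
      unfolding m_def by (intro suminf_sum) auto
    also have "\<dots> = m (\<Union>i. A i)"
      unfolding m_def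
    proof (intro sum.cong refl)
      fix \<nu> assume "\<nu> \<in> T"
      then have "(\<Sum>i. emeasure \<nu> (A i)) = emeasure \<nu> (\<Union>i. A i)"
        using A T(2) Prob_sets by (intro suminf_emeasure) auto
      then show "(\<Sum>i. ennreal (w \<nu>) * emeasure \<nu> (A i)) = ennreal (w \<nu>) * emeasure \<nu> (\<Union>i. A i)"
        by simp
    qed
    finally show "(\<Sum>i. m (A i)) = m (\<Union>i. A i)" .
  qed
  then have emeasure: "emeasure \<mu> F = m F" if "F \<in> sets seq_borel" for F
    using that sets.sigma_algebra_axioms[of "seq_borel :: (nat \<Rightarrow> 'a) measure"] unfolding \<mu>_def
    by (intro emeasure_measure_of_sigma) (auto simp: positive_def m_def)
  have m: "m F = ennreal (\<Sum>\<nu>\<in>T. w \<nu> * measure \<nu> F)" for F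
  proof -
    have "m F = (\<Sum>\<nu>\<in>T. ennreal (w \<nu> * measure \<nu> F))"
      unfolding m_def
    proof (intro sum.cong refl)
      fix \<nu> assume "\<nu> \<in> T"
      then interpret prob_space \<nu> using T(2) Prob_prob_space by blast
      show "ennreal (w \<nu>) * emeasure \<nu> F = ennreal (w \<nu> * measure \<nu> F)"
        using w(1)[OF \<open>\<nu> \<in> T\<close>] by (simp add: emeasure_eq_measure ennreal_mult)
    qed
    also have "\<dots> = ennreal (\<Sum>\<nu>\<in>T. w \<nu> * measure \<nu> F)"
      using w(1) by (intro sum_ennreal) auto
    finally show ?thesis .
  qed
  have "measure \<nu> UNIV = 1" if "\<nu> \<in> T" for \<nu>
    using that T(2) prob_space.prob_space[OF Prob_prob_space] Prob_space by (metis subsetD)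
  then have "m UNIV = 1" using w(2) by (simp add: m)
  moreover have "space \<mu> = UNIV" by (simp add: \<mu>_def space_measure_of_conv)
  ultimately have "prob_space \<mu>"
    using emeasure[of UNIV] sets.top[of seq_borel] by (intro prob_spaceI) simp
  with sets have "\<mu> \<in> Prob" by (simp add: Prob_def)
  moreover have "measure \<mu> F = (\<Sum>\<nu>\<in>T. w \<nu> * measure \<nu> F)" if "F \<in> sets seq_borel" for F
    using emeasure[OF that] w(1) by (simp add: m measure_def sum_nonneg)
  ultimately show thesis using that by blast
qed

lemma integral_mixture:
  fixes h :: "(nat \<Rightarrow> 'a::finite) \<Rightarrow> real"
  assumes T: "finite T" "T \<subseteq> Prob" and w: "\<And>\<nu>. \<nu> \<in> T \<Longrightarrow> 0 \<le> w \<nu>" "(\<Sum>\<nu>\<in>T. w \<nu>) = (1::real)"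
    and \<mu>: "\<mu> \<in> Prob"
    and mix: "\<And>F. F \<in> sets seq_borel \<Longrightarrow> measure \<mu> F = (\<Sum>\<nu>\<in>T. w \<nu> * measure \<nu> F)"
    and h: "h \<in> Cont"
  shows "(\<integral>x. h x \<partial>\<mu>) = (\<Sum>\<nu>\<in>T. w \<nu> * (\<integral>x. h x \<partial>\<nu>))"
proof -
  have "\<bar>(\<integral>x. h x \<partial>\<mu>) - (\<Sum>\<nu>\<in>T. w \<nu> * (\<integral>x. h x \<partial>\<nu>))\<bar> \<le> e" if "e > 0" for e
  proof -
    obtain n where n: "\<And>\<nu>. \<nu> \<in> Prob \<Longrightarrow>
        \<bar>(\<integral>x. h x \<partial>\<nu>) - (\<Sum>v\<in>words n. h v * measure \<nu> {x. agree n v x})\<bar> \<le> e / 2"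
      using integral_approx_cylinders[OF h, of "e / 2"] \<open>e > 0\<close> by auto
    define s where "s \<nu> = (\<Sum>v\<in>words n. h v * measure \<nu> {x. agree n v x})" for \<nu>
    have "s \<mu> = (\<Sum>v\<in>words n. \<Sum>\<nu>\<in>T. w \<nu> * (h v * measure \<nu> {x. agree n v x}))"
      unfolding s_def by (simp add: mix[OF cylinder_borel[OF cylinder_of_word]] sum_distrib_left mult_ac)
    also have "\<dots> = (\<Sum>\<nu>\<in>T. w \<nu> * s \<nu>)"
      unfolding s_def sum_distrib_left by (rule sum.swap)
    finally have s: "s \<mu> = (\<Sum>\<nu>\<in>T. w \<nu> * s \<nu>)" .
    have "\<bar>(\<Sum>\<nu>\<in>T. w \<nu> * (\<integral>x. h x \<partial>\<nu>)) - (\<Sum>\<nu>\<in>T. w \<nu> * s \<nu>)\<bar>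
        \<le> (\<Sum>\<nu>\<in>T. \<bar>w \<nu> * ((\<integral>x. h x \<partial>\<nu>) - s \<nu>)\<bar>)"
      by (simp add: sum_subtractf[symmetric] right_diff_distrib[symmetric])
    also have "\<dots> \<le> (\<Sum>\<nu>\<in>T. w \<nu> * (e / 2))"
    proof (rule sum_mono)
      fix \<nu> assume \<nu>: "\<nu> \<in> T"
      have "\<bar>(\<integral>x. h x \<partial>\<nu>) - s \<nu>\<bar> \<le> e / 2" unfolding s_def using n T(2) \<nu> by blast
      then have "w \<nu> * \<bar>(\<integral>x. h x \<partial>\<nu>) - s \<nu>\<bar> \<le> w \<nu> * (e / 2)"
        using w(1)[OF \<nu>] by (rule mult_left_mono)
      then show "\<bar>w \<nu> * ((\<integral>x. h x \<partial>\<nu>) - s \<nu>)\<bar> \<le> w \<nu> * (e / 2)"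
        using w(1)[OF \<nu>] by (simp add: abs_mult)
    qed
    also have "\<dots> = e / 2" using w(2) by (metis mult_1 sum_distrib_right)
    finally show ?thesis using n[OF \<mu>] s unfolding s_def by linarith
  qed
  then have "\<bar>(\<integral>x. h x \<partial>\<mu>) - (\<Sum>\<nu>\<in>T. w \<nu> * (\<integral>x. h x \<partial>\<nu>))\<bar> \<le> 0"
    by (rule field_le_epsilon) simp
  then show ?thesis by simp
qed

text \<open>
  A finite-dimensional separation theorem in contrapositive form, for coordinates \<open>\<phi> i\<close> on an
  arbitrary set: if no linear functional separates \<open>v\<close> from \<open>S\<close>, then convex combinations of
  \<open>S\<close> come arbitrarily close to \<open>v\<close>.  The proof is the descent step of the Frank--Wolfe
  method.  Let \<open>c\<close> be a convex combination nearly minimising the squared distance \<open>Q c\<close> to \<open>v\<close>.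
  The functional with coefficients \<open>v i - c i\<close> is, up to \<open>\<eta>\<close>, at least as large at some point
  of \<open>S\<close> as at \<open>v\<close>; moving \<open>c\<close> by a fraction \<open>t\<close> towards that point lowers \<open>Q\<close> by at least
  \<open>2 t (Q c - \<eta>) - t\<^sup>2 R\<close>, which contradicts minimality for small \<open>t\<close> if the infimum is positive.
\<close>

lemma convex_combination_approx:
  fixes \<phi> :: "'i \<Rightarrow> 'm \<Rightarrow> real" and v :: "'i \<Rightarrow> real"
  assumes I: "finite I"
    and B: "\<And>i s. i \<in> I \<Longrightarrow> s \<in> S \<Longrightarrow> \<bar>\<phi> i s\<bar> \<le> B i"
    and nonsep: "\<And>a \<eta>. \<eta> > 0 \<Longrightarrow> \<exists>s\<in>S. (\<Sum>i\<in>I. a i * v i) - \<eta> \<le> (\<Sum>i\<in>I. a i * \<phi> i s)"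
    and e: "e > 0"
  obtains T w where "finite T" "T \<subseteq> S" "\<And>s. s \<in> T \<Longrightarrow> 0 \<le> w s" "(\<Sum>s\<in>T. w s) = (1::real)"
    "\<And>i. i \<in> I \<Longrightarrow> \<bar>(\<Sum>s\<in>T. w s * \<phi> i s) - v i\<bar> < e"
proof -
  define conv where "conv T w \<longleftrightarrow> finite T \<and> T \<subseteq> S \<and> (\<forall>s\<in>T. 0 \<le> w s) \<and> (\<Sum>s\<in>T. w s) = (1::real)"
    for T and w :: "'m \<Rightarrow> real"
  define C where "C = {\<lambda>i. \<Sum>s\<in>T. w s * \<phi> i s | T w. conv T w}"
  define Q where "Q c = (\<Sum>i\<in>I. (v i - c i)\<^sup>2)" for c
  have step: "(\<lambda>i. (1 - t) * c i + t * \<phi> i r) \<in> C"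
    if "c \<in> C" and r: "r \<in> S" and t: "0 \<le> t" "t \<le> 1" for c r t
  proof -
    obtain T w where Tw: "conv T w" and c: "c = (\<lambda>i. \<Sum>s\<in>T. w s * \<phi> i s)"
      using \<open>c \<in> C\<close> unfolding C_def by blast
    define u where "u s = (1 - t) * (if s \<in> T then w s else 0) + t * (if s = r then 1 else 0)" for s
    have fin: "finite (insert r T)" using Tw by (simp add: conv_def)
    have u: "(\<Sum>s\<in>insert r T. u s * g s) = (1 - t) * (\<Sum>s\<in>T. w s * g s) + t * g r" for g
    proof -
      have "(\<Sum>s\<in>insert r T. u s * g s)
          = (1 - t) * (\<Sum>s\<in>insert r T. if s \<in> T then w s * g s else 0)
            + t * (\<Sum>s\<in>insert r T. if s = r then g s else 0)"
        unfolding sum_distrib_left sum.distrib[symmetric]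
        by (intro sum.cong) (auto simp: u_def algebra_simps)
      also have "(\<Sum>s\<in>insert r T. if s \<in> T then w s * g s else 0) = (\<Sum>s\<in>T. w s * g s)"
        using fin by (intro sum.mono_neutral_cong_right) auto
      also have "(\<Sum>s\<in>insert r T. if s = r then g s else 0) = g r"
        using fin by (subst sum.delta) auto
      finally show ?thesis .
    qed
    have "conv (insert r T) u"
      using Tw r t u[of "\<lambda>_. 1"] by (auto simp: conv_def u_def)
    moreover have "(\<lambda>i. (1 - t) * c i + t * \<phi> i r) = (\<lambda>i. \<Sum>s\<in>insert r T. u s * \<phi> i s)"
      by (simp add: u c)
    ultimately show ?thesis unfolding C_def by blast
  qed
  have C_bound: "\<bar>c i\<bar> \<le> B i" if "c \<in> C" and i: "i \<in> I" for c i
  proof -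
    obtain T w where Tw: "conv T w" and c: "c = (\<lambda>i. \<Sum>s\<in>T. w s * \<phi> i s)"
      using \<open>c \<in> C\<close> unfolding C_def by blast
    have "\<bar>c i\<bar> \<le> (\<Sum>s\<in>T. \<bar>w s * \<phi> i s\<bar>)" unfolding c by (rule sum_abs)
    also have "\<dots> \<le> (\<Sum>s\<in>T. w s * B i)"
      using Tw B[OF i] by (intro sum_mono) (auto simp: conv_def abs_mult intro!: mult_left_mono)
    also have "\<dots> = B i" using Tw by (simp add: conv_def sum_distrib_right[symmetric])
    finally show ?thesis .
  qed
  obtain s0 where "s0 \<in> S" using nonsep[of 1 "\<lambda>_. 0"] by auto
  then have "conv {s0} (\<lambda>_. 1)" by (simp add: conv_def)
  then have C_ne: "C \<noteq> {}" unfolding C_def by blast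
  have Q_nonneg: "0 \<le> Q c" for c unfolding Q_def by (simp add: sum_nonneg)
  then have bdd: "bdd_below (Q ` C)" by (intro bdd_belowI[of _ 0]) auto
  define d where "d = Inf (Q ` C)"
  have d_le: "d \<le> Q c" if "c \<in> C" for c
    unfolding d_def using that bdd by (intro cInf_lower) auto
  have approx: "\<exists>c\<in>C. Q c < d + \<delta>" if "\<delta> > 0" for \<delta>
    using cInf_lessD[of "Q ` C" "d + \<delta>"] C_ne that unfolding d_def by auto
  have "d \<le> 0"
  proof (rule ccontr)
    assume "\<not> d \<le> 0"
    then have d: "d > 0" by simp
    define R where "R = (\<Sum>i\<in>I. (2 * B i)\<^sup>2)"
    \<comment> \<open>The step size is chosen so that the quadratic term \<open>t\<^sup>2 R\<close> is at most \<open>t d / 2\<close>; with \<open>\<eta> = d / 4\<close>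
      the total decrease is at least \<open>t d\<close>.\<close>
    define t where "t = min 1 (d / (2 * (R + 1)))"
    have R: "0 \<le> R" unfolding R_def by (simp add: sum_nonneg)
    have t: "0 < t" "t \<le> 1" using d R by (auto simp: t_def)
    have tR: "t * R \<le> d / 2"
    proof -
      have "t * R \<le> d / (2 * (R + 1)) * (R + 1)"
        using R t d by (intro mult_mono) (auto simp: t_def)
      also have "\<dots> = d / 2" using R by (simp add: field_simps)
      finally show ?thesis .
    qed
    obtain c where c: "c \<in> C" "Q c < d + t * d" using approx[of "t * d"] t d by auto
    obtain r where r: "r \<in> S"
        "(\<Sum>i\<in>I. (v i - c i) * v i) - d / 4 \<le> (\<Sum>i\<in>I. (v i - c i) * \<phi> i r)"
      using nonsep[of "d / 4" "\<lambda>i. v i - c i"] d by auto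
    have inner: "Q c - d / 4 \<le> (\<Sum>i\<in>I. (v i - c i) * (\<phi> i r - c i))"
    proof -
      have "Q c = (\<Sum>i\<in>I. (v i - c i) * v i) - (\<Sum>i\<in>I. (v i - c i) * c i)"
        by (simp add: Q_def sum_subtractf[symmetric] power2_eq_square algebra_simps)
      moreover have "(\<Sum>i\<in>I. (v i - c i) * (\<phi> i r - c i))
          = (\<Sum>i\<in>I. (v i - c i) * \<phi> i r) - (\<Sum>i\<in>I. (v i - c i) * c i)"
        by (simp add: sum_subtractf[symmetric] algebra_simps)
      ultimately show ?thesis using r(2) by linarith
    qed
    have quad: "(\<Sum>i\<in>I. (\<phi> i r - c i)\<^sup>2) \<le> R"
      unfolding R_def
    proof (rule sum_mono)
      fix i assume i: "i \<in> I"
      have "\<bar>\<phi> i r - c i\<bar> \<le> 2 * B i" using B[OF i r(1)] C_bound[OF c(1) i] by linarith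
      then show "(\<phi> i r - c i)\<^sup>2 \<le> (2 * B i)\<^sup>2" using abs_le_square_iff[of "\<phi> i r - c i" "2 * B i"] by linarith
    qed
    let ?c = "\<lambda>i. (1 - t) * c i + t * \<phi> i r"
    have "Q ?c = (\<Sum>i\<in>I. (v i - c i)\<^sup>2 - 2 * t * ((v i - c i) * (\<phi> i r - c i)) + t\<^sup>2 * (\<phi> i r - c i)\<^sup>2)"
      unfolding Q_def by (intro sum.cong) (auto simp: power2_eq_square algebra_simps)
    also have "\<dots> = Q c - 2 * t * (\<Sum>i\<in>I. (v i - c i) * (\<phi> i r - c i))
        + t * (t * (\<Sum>i\<in>I. (\<phi> i r - c i)\<^sup>2))"
      by (simp add: Q_def sum.distrib sum_subtractf sum_distrib_left power2_eq_square mult_ac)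
    also have "\<dots> \<le> Q c - 2 * t * (3 / 4 * d) + t * (d / 2)"
    proof -
      have "2 * t * (3 / 4 * d) \<le> 2 * t * (\<Sum>i\<in>I. (v i - c i) * (\<phi> i r - c i))"
        using inner d_le[OF c(1)] t by (intro mult_left_mono) auto
      moreover have "t * (\<Sum>i\<in>I. (\<phi> i r - c i)\<^sup>2) \<le> d / 2"
        using mult_left_mono[OF quad, of t] t tR by linarith
      then have "t * (t * (\<Sum>i\<in>I. (\<phi> i r - c i)\<^sup>2)) \<le> t * (d / 2)"
        using t by (intro mult_left_mono) auto
      ultimately show ?thesis by linarith
    qed
    also have "\<dots> < d" using c(2) by (simp add: algebra_simps)
    finally have "Q ?c < d" .
    moreover have "?c \<in> C" using c(1) r(1) t by (intro step) auto
    ultimately show False using d_le by fastforce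
  qed
  moreover obtain c where c: "c \<in> C" "Q c < d + e\<^sup>2" using approx[of "e\<^sup>2"] e by auto
  ultimately have Q: "Q c < e\<^sup>2" by linarith
  obtain T w where Tw: "conv T w" "c = (\<lambda>i. \<Sum>s\<in>T. w s * \<phi> i s)"
    using c(1) unfolding C_def by blast
  have "\<bar>c i - v i\<bar> < e" if "i \<in> I" for i
  proof -
    have "(v i - c i)\<^sup>2 \<le> Q c" unfolding Q_def using I that by (intro member_le_sum) auto
    with Q have "\<bar>v i - c i\<bar>\<^sup>2 < e\<^sup>2" by simp
    then have "\<bar>v i - c i\<bar> < e" by (rule power2_less_imp_less) (use e in simp)
    then show ?thesis by linarith
  qed
  then have "\<bar>(\<Sum>s\<in>T. w s * \<phi> i s) - v i\<bar> < e" if "i \<in> I" for i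
    using that unfolding Tw(2) by blast
  moreover have "finite T" "T \<subseteq> S" "\<And>s. s \<in> T \<Longrightarrow> 0 \<le> w s" "(\<Sum>s\<in>T. w s) = 1"
    using Tw(1) unfolding conv_def by blast+
  ultimately show thesis using that by blast
qed

section \<open>The kernels as operators\<close>

definition kern_op ::
  "((nat \<Rightarrow> 'a) \<Rightarrow> real) \<Rightarrow> nat \<Rightarrow> ((nat \<Rightarrow> 'a) \<Rightarrow> real) \<Rightarrow> (nat \<Rightarrow> 'a) \<Rightarrow> real" where
  "kern_op f n h y =
     (1 / partition_fun f n y) *
     (\<Sum>x | (seq_shift ^^ n) x = (seq_shift ^^ n) y. h x * exp (birkhoff f n x))"

lemma kern_eq_kern_op: "kern f n F = kern_op f n (indicator F)"
  by (intro ext) (simp only: kern_def kern_op_def)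

lemma shift_eq_iff: "(seq_shift ^^ n) x = (seq_shift ^^ n) y \<longleftrightarrow> (\<forall>i\<ge>n. x i = y i)"
proof
  assume "(seq_shift ^^ n) x = (seq_shift ^^ n) y"
  then have "x (i + n) = y (i + n)" for i by (simp add: seq_shift_funpow fun_eq_iff)
  then show "\<forall>i\<ge>n. x i = y i" by (metis le_add_diff_inverse2)
qed (simp add: seq_shift_funpow)

lemma shift_eq_mono:
  "(seq_shift ^^ n) x = (seq_shift ^^ n) y \<Longrightarrow> n \<le> r \<Longrightarrow> (seq_shift ^^ r) x = (seq_shift ^^ r) y"
  by (simp add: shift_eq_iff)

lemma sum_fiber:
  "(\<Sum>x | (seq_shift ^^ n) x = (seq_shift ^^ n) y. \<phi> x) = (\<Sum>w\<in>words n. \<phi> (concat_at n w y))"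
proof -
  have "bij_betw (\<lambda>w. concat_at n w y) (words n) {x. (seq_shift ^^ n) x = (seq_shift ^^ n) y}"
  proof (rule bij_betwI[where g = "\<lambda>x. restrict x {..<n}"])
    show "(\<lambda>w. concat_at n w y) \<in> words n \<rightarrow> {x. (seq_shift ^^ n) x = (seq_shift ^^ n) y}"
      by (auto simp: shift_eq_iff concat_at_def)
    show "(\<lambda>x. restrict x {..<n}) \<in> {x. (seq_shift ^^ n) x = (seq_shift ^^ n) y} \<rightarrow> words n"
      by (auto simp: restrict_in_words)
    show "restrict (concat_at n w y) {..<n} = w" if "w \<in> words n" for w
    proof
      fix i
      show "restrict (concat_at n w y) {..<n} i = w i"
        using PiE_arb[of w "{..<n}" "\<lambda>_. UNIV" i] that
        by (cases "i < n") (simp_all add: words_def concat_at_def)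
    qed
    show "concat_at n (restrict x {..<n}) y = x"
      if "x \<in> {x. (seq_shift ^^ n) x = (seq_shift ^^ n) y}" for x
      using that by (intro ext) (simp add: shift_eq_iff concat_at_def)
  qed
  from sum.reindex_bij_betw[OF this, of \<phi>] show ?thesis by simp
qed

lemma birkhoff_add:
  "birkhoff f (n + m) x = birkhoff f n x + birkhoff f m ((seq_shift ^^ n) x)"
  by (induction m) (simp_all add: birkhoff_def seq_shift_funpow add_ac)

lemma partition_fun_cong:
  "(seq_shift ^^ n) x = (seq_shift ^^ n) y \<Longrightarrow> partition_fun f n x = partition_fun f n y"
  by (simp add: partition_fun_def)

lemma kern_op_nonneg:
  fixes y :: "nat \<Rightarrow> 'a::finite"
  assumes "\<And>x. 0 \<le> h x"
  shows "0 \<le> kern_op f n h y"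
  unfolding kern_op_def using assms partition_fun_pos[of f n y]
  by (intro mult_nonneg_nonneg sum_nonneg) auto

lemma kern_nonneg: "0 \<le> kern f n F (y :: nat \<Rightarrow> 'a::finite)"
  unfolding kern_eq_kern_op by (rule kern_op_nonneg) simp

lemma measure_kern_measure:
  fixes y :: "nat \<Rightarrow> 'a::finite"
  assumes "F \<in> sets seq_borel"
  shows "measure (kern_measure f n y) F = kern f n F y"
  using emeasure_kern_measure[OF assms, of f n y] kern_nonneg[of f n F y] by (simp add: measure_def)

lemma kern_le_1: "F \<in> sets seq_borel \<Longrightarrow> kern f n F (y :: nat \<Rightarrow> 'a::finite) \<le> 1"
  using prob_space.prob_le_1[OF Prob_prob_space[OF kern_measure_in_Prob[of f n y]], of F]
  by (simp add: measure_kern_measure)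

lemma integral_kern_measure:
  fixes y :: "nat \<Rightarrow> 'a::finite"
  assumes h: "h \<in> borel_measurable seq_borel"
  shows "(\<integral>x. h x \<partial>kern_measure f n y) = kern_op f n h y"
proof -
  define S where "S = {x. (seq_shift ^^ n) x = (seq_shift ^^ n) y}"
  define c where "c x = exp (birkhoff f n x) / partition_fun f n y" for x
  have fin: "finite S" unfolding S_def by (rule finite_fiber)
  have c: "0 \<le> c x" for x
    using partition_fun_pos[of f n y] by (simp add: c_def)
  have id: "(\<lambda>x. x) \<in> measurable (point_measure S (\<lambda>x. ennreal (c x))) seq_borel"
    by (auto simp: measurable_point_measure_eq1)
  have "kern_measure f n y = distr (point_measure S (\<lambda>x. ennreal (c x))) seq_borel (\<lambda>x. x)"
  proof (rule measure_eqI)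
    show "sets (kern_measure f n y) = sets (distr (point_measure S (\<lambda>x. ennreal (c x))) seq_borel (\<lambda>x. x))"
      using Prob_sets[OF kern_measure_in_Prob] by simp
    fix A assume "A \<in> sets (kern_measure f n y)"
    then have A: "A \<in> sets seq_borel" using Prob_sets[OF kern_measure_in_Prob] by blast
    have "emeasure (distr (point_measure S (\<lambda>x. ennreal (c x))) seq_borel (\<lambda>x. x)) A
        = emeasure (point_measure S (\<lambda>x. ennreal (c x))) (A \<inter> S)"
      using A id by (subst emeasure_distr) (auto simp: space_point_measure)
    also have "\<dots> = (\<Sum>x\<in>A \<inter> S. ennreal (c x))"
      using fin by (intro emeasure_point_measure_finite) auto
    also have "\<dots> = ennreal (\<Sum>x\<in>A \<inter> S. c x)"
      using c by (intro sum_ennreal) auto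
    also have "(\<Sum>x\<in>A \<inter> S. c x) = (\<Sum>x\<in>S. indicator A x * c x)"
      using fin by (intro sum.mono_neutral_cong_left) (auto simp: indicator_def)
    also have "\<dots> = kern f n A y"
      unfolding kern_def S_def c_def by (simp add: sum_distrib_left)
    finally show "emeasure (kern_measure f n y) A
        = emeasure (distr (point_measure S (\<lambda>x. ennreal (c x))) seq_borel (\<lambda>x. x)) A"
      using emeasure_kern_measure[OF A] by simp
  qed
  then have "(\<integral>x. h x \<partial>kern_measure f n y) = (\<integral>x. h x \<partial>point_measure S (\<lambda>x. ennreal (c x)))"
    using h id by (simp add: integral_distr)
  also have "\<dots> = (\<Sum>x\<in>S. c x * h x)"
    using fin c by (simp add: lebesgue_integral_point_measure_finite)
  also have "\<dots> = kern_op f n h y"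
    by (simp add: kern_op_def S_def c_def sum_distrib_left mult_ac)
  finally show ?thesis .
qed

lemma abs_kern_op_le:
  fixes y :: "nat \<Rightarrow> 'a::finite"
  assumes "\<And>x. \<bar>h x\<bar> \<le> B"
  shows "\<bar>kern_op f n h y\<bar> \<le> B"
proof -
  have Z: "0 < partition_fun f n y" by (rule partition_fun_pos)
  have "\<bar>\<Sum>x | (seq_shift ^^ n) x = (seq_shift ^^ n) y. h x * exp (birkhoff f n x)\<bar>
      \<le> (\<Sum>x | (seq_shift ^^ n) x = (seq_shift ^^ n) y. \<bar>h x * exp (birkhoff f n x)\<bar>)"
    by (rule sum_abs)
  also have "\<dots> \<le> (\<Sum>x | (seq_shift ^^ n) x = (seq_shift ^^ n) y. B * exp (birkhoff f n x))"
    using assms by (intro sum_mono) (simp add: abs_mult)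
  also have "\<dots> = B * partition_fun f n y" by (simp add: partition_fun_def sum_distrib_left)
  finally show ?thesis using Z by (simp add: kern_op_def abs_mult field_simps)
qed

lemma Cont_birkhoff: "f \<in> Cont \<Longrightarrow> birkhoff f n \<in> Cont"
  unfolding birkhoff_def by (rule Cont_sum) (rule Cont_compose[OF _ continuous_map_shift])

text \<open>
  Written as a sum over the words that replace the first \<open>n\<close> letters of \<open>y\<close>, the kernel averages
  depend continuously on \<open>y\<close>.
\<close>

lemma Cont_kern_op:
  fixes f :: "(nat \<Rightarrow> 'a::finite) \<Rightarrow> real"
  assumes "f \<in> Cont" "h \<in> Cont"
  shows "kern_op f n h \<in> Cont"
proof -
  have cont: "(\<lambda>y. \<Sum>w\<in>words n. g (concat_at n w y) * exp (birkhoff f n (concat_at n w y))) \<in> Cont"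
    if "g \<in> Cont" for g
    using Cont_compose[OF that continuous_map_concat_at]
      Cont_compose[OF Cont_birkhoff[OF assms(1)] continuous_map_concat_at]
    by (intro Cont_sum Cont_mult Cont_exp)
  have Z: "partition_fun f n = (\<lambda>y. \<Sum>w\<in>words n. 1 * exp (birkhoff f n (concat_at n w y)))"
    by (intro ext) (simp only: partition_fun_def sum_fiber mult_1)
  have "partition_fun f n \<in> Cont" unfolding Z using cont[of "\<lambda>_. 1"] by simp
  moreover have Z_ne: "partition_fun f n y \<noteq> 0" for y :: "nat \<Rightarrow> 'a"
    using partition_fun_pos[of f n y] by simp
  ultimately have "(\<lambda>y. (\<Sum>w\<in>words n. h (concat_at n w y) * exp (birkhoff f n (concat_at n w y)))
      / partition_fun f n y) \<in> Cont"
    using cont[OF assms(2)] by (intro Cont_divide)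
  moreover have "kern_op f n h = (\<lambda>y. (\<Sum>w\<in>words n. h (concat_at n w y) *
      exp (birkhoff f n (concat_at n w y))) / partition_fun f n y)"
    by (intro ext) (simp only: kern_op_def sum_fiber times_divide_eq_left mult_1)
  ultimately show ?thesis by simp
qed

text \<open>
  Averaging over the first \<open>n\<close> letters leaves an average over the first \<open>r \<ge> n\<close> letters
  unchanged: the weight of \<open>x\<close> in \<open>K\<^sub>r\<close> is its weight in \<open>K\<^sub>n\<close> times a factor that depends only on
  the letters from \<open>n\<close> on.
\<close>

lemma kern_op_consistent:
  fixes y :: "nat \<Rightarrow> 'a::finite"
  assumes "n \<le> r"
  shows "kern_op f r (kern_op f n h) y = kern_op f r h y"
proof -
  define E where "E = {x. (seq_shift ^^ r) x = (seq_shift ^^ r) y}"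
  have fin: "finite E" unfolding E_def by (rule finite_fiber)
  let ?R = "\<lambda>x z. (seq_shift ^^ n) x = (seq_shift ^^ n) z"
  \<comment> \<open>The unnormalised weight of \<open>x\<close> in \<open>K\<^sub>r\<close> is \<open>W x\<close> times the unnormalised weight and the
    normalising constant of \<open>K\<^sub>n\<close>; \<open>W\<close> depends only on the letters from \<open>n\<close> on.\<close>
  define W where "W x = exp (birkhoff f (r - n) ((seq_shift ^^ n) x)) / partition_fun f n x" for x
  have exp_r: "exp (birkhoff f r x) = exp (birkhoff f n x) * (W x * partition_fun f n x)" for x
    using birkhoff_add[of f n "r - n" x] assms partition_fun_pos[of f n x]
    by (simp add: exp_add W_def)
  have fiber: "{z. ?R z x} = {z \<in> E. ?R x z}" if "x \<in> E" for x
  proof (rule Collect_cong)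
    fix z
    show "?R z x \<longleftrightarrow> z \<in> E \<and> ?R x z"
    proof
      assume *: "?R z x"
      then have "(seq_shift ^^ r) z = (seq_shift ^^ r) x" by (rule shift_eq_mono[OF _ assms])
      with that have "z \<in> E" unfolding E_def mem_Collect_eq by (rule trans[rotated])
      with * show "z \<in> E \<and> ?R x z" by simp
    next
      assume "z \<in> E \<and> ?R x z"
      then show "?R z x" by simp
    qed
  qed
  have "(\<Sum>x\<in>E. kern_op f n h x * exp (birkhoff f r x))
      = (\<Sum>x\<in>E. \<Sum>z | z \<in> E \<and> ?R x z. h z * exp (birkhoff f n z) * exp (birkhoff f n x) * W z)"
  proof (intro sum.cong refl)
    fix x assume x: "x \<in> E"
    have "kern_op f n h x * exp (birkhoff f r x)
        = (\<Sum>z | ?R z x. h z * exp (birkhoff f n z)) * (exp (birkhoff f n x) * W x)"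
      using partition_fun_pos[of f n x] by (simp add: kern_op_def exp_r)
    also have "\<dots> = (\<Sum>z | ?R z x. h z * exp (birkhoff f n z) * exp (birkhoff f n x) * W z)"
      unfolding sum_distrib_right
    proof (intro sum.cong refl)
      fix z assume "z \<in> {z. ?R z x}"
      then have "W x = W z" using partition_fun_cong[of n z x f] by (simp add: W_def)
      then show "h z * exp (birkhoff f n z) * (exp (birkhoff f n x) * W x)
          = h z * exp (birkhoff f n z) * exp (birkhoff f n x) * W z" by simp
    qed
    finally show "kern_op f n h x * exp (birkhoff f r x)
        = (\<Sum>z | z \<in> E \<and> ?R x z. h z * exp (birkhoff f n z) * exp (birkhoff f n x) * W z)"
      unfolding fiber[OF x] .
  qed
  also have "\<dots> = (\<Sum>z\<in>E. \<Sum>x | x \<in> E \<and> ?R x z. h z * exp (birkhoff f n z) * exp (birkhoff f n x) * W z)"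
    by (rule sum.swap_restrict[OF fin fin])
  also have "\<dots> = (\<Sum>z\<in>E. h z * exp (birkhoff f r z))"
  proof (intro sum.cong refl)
    fix z assume z: "z \<in> E"
    have "{x \<in> E. ?R x z} = {x. ?R x z}" using fiber[OF z] by auto
    then have "(\<Sum>x | x \<in> E \<and> ?R x z. h z * exp (birkhoff f n z) * exp (birkhoff f n x) * W z)
        = h z * exp (birkhoff f n z) * W z * partition_fun f n z"
      by (simp add: partition_fun_def sum_distrib_left mult_ac)
    then show "(\<Sum>x | x \<in> E \<and> ?R x z. h z * exp (birkhoff f n z) * exp (birkhoff f n x) * W z)
        = h z * exp (birkhoff f r z)" by (simp add: exp_r)
  qed
  finally show ?thesis by (simp add: kern_op_def E_def)
qed


section \<open>Tail events\<close>

lemma space_tail_algebra [simp]: "space (tail_algebra n) = UNIV"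
  by (simp add: tail_algebra_def)

lemma sets_tail_algebra:
  "sets (tail_algebra n) = sigma_sets UNIV {(\<lambda>x. x i) -` A | i A. n \<le> i}"
  by (simp add: tail_algebra_def)

lemma coord_in_tail_algebra: "n \<le> i \<Longrightarrow> (\<lambda>x. x i) -` A \<in> sets (tail_algebra n)"
  unfolding sets_tail_algebra by (rule sigma_sets.Basic) blast

lemma tail_event_shift_invariant:
  assumes "A \<in> sets (tail_algebra n)" "(seq_shift ^^ n) x = (seq_shift ^^ n) y"
  shows "x \<in> A \<longleftrightarrow> y \<in> A"
  using assms(1) unfolding sets_tail_algebra
proof induction
  case (Basic a)
  then show ?case using assms(2) by (auto simp: shift_eq_iff)
qed auto

lemma tail_algebra_borel: "sets (tail_algebra n) \<subseteq> sets seq_borel"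
  unfolding sets_tail_algebra sets_seq_borel
  by (rule sigma_sets_mono') (auto simp: openin_seq_top_coord)

lemma cylinder_in_tail_algebra_0:
  fixes A :: "(nat \<Rightarrow> 'a::finite) set"
  assumes "A \<in> cylinder_sets"
  shows "A \<in> sets (tail_algebra 0)"
proof -
  obtain n where n: "\<And>x y. agree n x y \<Longrightarrow> x \<in> A \<Longrightarrow> y \<in> A"
    using assms unfolding cylinder_sets_def by blast
  have "{x. agree n w x} \<in> sets (tail_algebra 0)" for w :: "nat \<Rightarrow> 'a"
  proof -
    have "{x \<in> space (tail_algebra 0). \<forall>i\<in>{..<n}. x i \<in> {w i}} \<in> sets (tail_algebra 0)"
    proof (rule sets.sets_Collect_finite_All)
      fix i
      show "{x \<in> space (tail_algebra 0). x i \<in> {w i}} \<in> sets (tail_algebra 0)"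
        using coord_in_tail_algebra[of 0 i "{w i}"] by (simp add: vimage_def)
    qed simp
    moreover have "{x. agree n w x} = {x \<in> space (tail_algebra 0). \<forall>i\<in>{..<n}. x i \<in> {w i}}"
      by (auto simp: agree_def)
    ultimately show ?thesis by simp
  qed
  then have "(\<Union>w\<in>words n \<inter> A. {x. agree n w x}) \<in> sets (tail_algebra 0)"
    by (intro sets.finite_UN) auto
  moreover have "A = (\<Union>w\<in>words n \<inter> A. {x. agree n w x})"
  proof
    show "A \<subseteq> (\<Union>w\<in>words n \<inter> A. {x. agree n w x})"
    proof
      fix x assume "x \<in> A"
      then have "restrict x {..<n} \<in> words n \<inter> A"
        using n agree_sym[OF agree_restrict] restrict_in_words by blast
      then show "x \<in> (\<Union>w\<in>words n \<inter> A. {x. agree n w x})"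
        using agree_restrict by (intro UN_I) auto
    qed
  qed (use n in auto)
  ultimately show ?thesis by simp
qed

text \<open>
  Replacing the first \<open>n\<close> letters by a fixed word erases the dependence on them, so the kernels are
  measurable with respect to the tail algebra although they are sums over points of the whole space.
\<close>

lemma concat_at_measurable_tail:
  "concat_at n (w :: nat \<Rightarrow> 'a::finite) \<in> measurable (tail_algebra n) seq_borel"
proof -
  have "concat_at n w \<in> measurable (tail_algebra n) (tail_algebra 0)"
    unfolding tail_algebra_def[of 0]
  proof (rule measurable_sigma_sets[where \<Omega> = UNIV and A = "{(\<lambda>x. x i) -` A | i A. 0 \<le> i}"])
    fix B :: "(nat \<Rightarrow> 'a) set" assume "B \<in> {(\<lambda>x. x i) -` A | i A. (0::nat) \<le> i}"
    then obtain i and A :: "'a set" where B: "B = (\<lambda>x. x i) -` A" by blast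
    show "concat_at n w -` B \<inter> space (tail_algebra n) \<in> sets (tail_algebra n)"
    proof (cases "i < n")
      case True
      then have "concat_at n w -` B = (if w i \<in> A then space (tail_algebra n) else {})"
        by (auto simp: B concat_at_def)
      then show ?thesis using sets.top[of "tail_algebra n :: (nat \<Rightarrow> 'a) measure"] by simp
    next
      case False
      then have "concat_at n w -` B = (\<lambda>x. x i) -` A" by (auto simp: B concat_at_def)
      then show ?thesis using False by (simp add: coord_in_tail_algebra)
    qed
  qed auto
  moreover have "sigma_sets UNIV cylinder_sets \<subseteq> sets (tail_algebra 0 :: (nat \<Rightarrow> 'a) measure)"
    using sets.sigma_sets_subset[of cylinder_sets "tail_algebra 0"] cylinder_in_tail_algebra_0 by auto
  then have "sets (tail_algebra 0 :: (nat \<Rightarrow> 'a) measure) = sets seq_borel"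
    using tail_algebra_borel[where ?'a = 'a, of 0] sets_seq_borel_cylinder[where ?'a = 'a]
    by (intro subset_antisym) simp_all
  ultimately show ?thesis using measurable_cong_sets by blast
qed

lemma kern_op_measurable_tail:
  fixes f :: "(nat \<Rightarrow> 'a::finite) \<Rightarrow> real"
  assumes "f \<in> Cont" and h: "h \<in> borel_measurable seq_borel"
  shows "kern_op f n h \<in> borel_measurable (tail_algebra n)"
proof -
  note [measurable] = concat_at_measurable_tail h Cont_borel[OF Cont_birkhoff[OF assms(1)]]
  show ?thesis
    unfolding kern_op_def partition_fun_def sum_fiber by measurable
qed

lemma kern_measurable_tail:
  fixes f :: "(nat \<Rightarrow> 'a::finite) \<Rightarrow> real"
  assumes "f \<in> Cont" and "F \<in> sets seq_borel"
  shows "kern f n F \<in> borel_measurable (tail_algebra n)"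
  unfolding kern_eq_kern_op using assms by (intro kern_op_measurable_tail) auto

lemma kern_measurable:
  fixes f :: "(nat \<Rightarrow> 'a::finite) \<Rightarrow> real"
  assumes "f \<in> Cont" "F \<in> sets seq_borel" "\<mu> \<in> Prob"
  shows "kern f n F \<in> borel_measurable \<mu>"
  using measurable_from_subalg[OF subalgebra_tail_algebra[OF assms(3)] kern_measurable_tail[OF assms(1,2)]] .

text \<open>
  \<open>K\<^sub>n(\<cdot>, y)\<close> is carried by points with the same tail as \<open>y\<close>, on which a tail event has the same
  truth value as at \<open>y\<close>.
\<close>

lemma kern_tail_event:
  assumes "A \<in> sets (tail_algebra n)"
  shows "kern f n (A \<inter> F) y = indicator A y * kern f n F y"
proof -
  have "(\<Sum>x | (seq_shift ^^ n) x = (seq_shift ^^ n) y. indicator (A \<inter> F) x * exp (birkhoff f n x))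
      = (\<Sum>x | (seq_shift ^^ n) x = (seq_shift ^^ n) y.
          indicator A y * (indicator F x * exp (birkhoff f n x)))"
  proof (intro sum.cong refl)
    fix x assume "x \<in> {x. (seq_shift ^^ n) x = (seq_shift ^^ n) y}"
    then have "x \<in> A \<longleftrightarrow> y \<in> A" using tail_event_shift_invariant[OF assms] by blast
    then show "indicator (A \<inter> F) x * exp (birkhoff f n x)
        = indicator A y * (indicator F x * exp (birkhoff f n x))"
      by (simp add: indicator_def)
  qed
  then show ?thesis by (simp add: kern_def sum_distrib_left[symmetric])
qed

section \<open>Gibbs measures as invariant measures of the kernels\<close>

text \<open>
  Invariance is only asked for on cylinders, where the kernels are continuous functions: this makes
  it a closed condition in the weak-* topology.
\<close>

definition kern_invariant :: "((nat \<Rightarrow> 'a) \<Rightarrow> real) \<Rightarrow> (nat \<Rightarrow> 'a) measure set" where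
  "kern_invariant f = {\<mu> \<in> Prob. \<forall>n\<ge>1. \<forall>A\<in>cylinder_sets. (\<integral>y. kern f n A y \<partial>\<mu>) = measure \<mu> A}"

lemma kern_invariant_Prob: "\<mu> \<in> kern_invariant f \<Longrightarrow> \<mu> \<in> Prob"
  by (simp add: kern_invariant_def)

lemma Cont_kern:
  fixes f :: "(nat \<Rightarrow> 'a::finite) \<Rightarrow> real"
  shows "f \<in> Cont \<Longrightarrow> A \<in> cylinder_sets \<Longrightarrow> kern f n A \<in> Cont"
  unfolding kern_eq_kern_op by (intro Cont_kern_op Cont_indicator_cylinder)

text \<open>
  Both sides are measures in \<open>F\<close>, and the cylinders form a generator closed under intersection.
\<close>

lemma nn_integral_kern:
  fixes f :: "(nat \<Rightarrow> 'a::finite) \<Rightarrow> real"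
  assumes f: "f \<in> Cont" and \<mu>: "\<mu> \<in> kern_invariant f" and n: "n \<ge> 1" and F: "F \<in> sets seq_borel"
  shows "(\<integral>\<^sup>+y. ennreal (kern f n F y) \<partial>\<mu>) = emeasure \<mu> F"
proof -
  have \<mu>P: "\<mu> \<in> Prob" using \<mu> by (rule kern_invariant_Prob)
  interpret prob_space \<mu> using \<mu>P by (rule Prob_prob_space)
  have meas: "kern f n A \<in> borel_measurable \<mu>" if "A \<in> sets seq_borel" for A
    using kern_measurable[OF f that \<mu>P] .
  have borel: "A \<in> sets seq_borel" if "A \<in> sigma_sets UNIV cylinder_sets" for A :: "(nat \<Rightarrow> 'a) set"
    using that by (simp add: sets_seq_borel_cylinder)
  have "cylinder_sets \<subseteq> Pow (UNIV :: (nat \<Rightarrow> 'a) set)" "F \<in> sigma_sets UNIV cylinder_sets"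
    using F by (simp_all add: sets_seq_borel_cylinder)
  with Int_stable_cylinder_sets show ?thesis
  proof (induction rule: sigma_sets_induct_disjoint)
    case (basic A)
    have "(\<integral>\<^sup>+y. ennreal (kern f n A y) \<partial>\<mu>) = ennreal (\<integral>y. kern f n A y \<partial>\<mu>)"
      using Cont_integrable[OF Cont_kern[OF f basic] \<mu>P] kern_nonneg[of f n A]
      by (intro nn_integral_eq_integral) auto
    also have "\<dots> = emeasure \<mu> A"
      using \<mu> n basic by (simp add: kern_invariant_def emeasure_eq_measure)
    finally show ?case .
  next
    case empty
    then show ?case by (simp add: kern_def)
  next
    case (compl A)
    have A: "A \<in> sets seq_borel" using compl(1) by (rule borel)
    have "kern f n (UNIV - A) y = 1 - kern f n A y" for y
    proof -
      interpret K: prob_space "kern_measure f n y"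
        by (rule Prob_prob_space[OF kern_measure_in_Prob])
      have "UNIV - A \<in> sets seq_borel" using sets.compl_sets[OF A] by simp
      with A K.prob_compl[of A] show ?thesis
        using Prob_sets[OF kern_measure_in_Prob[of f n y]] Prob_space[OF kern_measure_in_Prob[of f n y]]
        by (simp add: measure_kern_measure)
    qed
    then have "(\<integral>\<^sup>+y. ennreal (kern f n (UNIV - A) y) \<partial>\<mu>) = (\<integral>\<^sup>+y. 1 - ennreal (kern f n A y) \<partial>\<mu>)"
      using kern_nonneg[of f n A] by (simp add: ennreal_minus[symmetric])
    also have "\<dots> = (\<integral>\<^sup>+y. 1 \<partial>\<mu>) - (\<integral>\<^sup>+y. ennreal (kern f n A y) \<partial>\<mu>)"
      using meas[OF A] compl.IH kern_le_1[OF A, of f n]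
      by (intro nn_integral_diff) auto
    also have "\<dots> = emeasure \<mu> (space \<mu>) - emeasure \<mu> A" using compl.IH by simp
    also have "\<dots> = emeasure \<mu> (UNIV - A)"
      using A Prob_sets[OF \<mu>P] Prob_space[OF \<mu>P] emeasure_compl[of A \<mu>] by simp
    finally show ?case .
  next
    case (union A)
    have A: "A i \<in> sets seq_borel" for i using union(2) borel by blast
    have K: "ennreal (kern f n (\<Union>i. A i) y) = (\<Sum>i. ennreal (kern f n (A i) y))" for y
    proof -
      have "(\<Sum>i. emeasure (kern_measure f n y) (A i)) = emeasure (kern_measure f n y) (\<Union>i. A i)"
        using A union(1) Prob_sets[OF kern_measure_in_Prob[of f n y]]
        by (intro suminf_emeasure) auto
      moreover have "(\<Union>i. A i) \<in> sets seq_borel" using A by blast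
      ultimately show ?thesis using A by (simp add: emeasure_kern_measure)
    qed
    have "(\<integral>\<^sup>+y. ennreal (kern f n (\<Union>i. A i) y) \<partial>\<mu>) = (\<Sum>i. \<integral>\<^sup>+y. ennreal (kern f n (A i) y) \<partial>\<mu>)"
      unfolding K using meas[OF A] by (intro nn_integral_suminf) simp
    also have "\<dots> = emeasure \<mu> (\<Union>i. A i)"
      using A union Prob_sets[OF \<mu>P] by (simp add: suminf_emeasure image_subset_iff)
    finally show ?case .
  qed
qed

lemma integral_kern:
  fixes f :: "(nat \<Rightarrow> 'a::finite) \<Rightarrow> real"
  assumes "f \<in> Cont" "\<mu> \<in> kern_invariant f" "n \<ge> 1" "F \<in> sets seq_borel"
  shows "(\<integral>y. kern f n F y \<partial>\<mu>) = measure \<mu> F"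
proof -
  have "(\<integral>y. kern f n F y \<partial>\<mu>) = enn2real (\<integral>\<^sup>+y. ennreal (kern f n F y) \<partial>\<mu>)"
    using kern_measurable[OF assms(1,4) kern_invariant_Prob[OF assms(2)]] kern_nonneg[of f n F]
    by (intro integral_eq_nn_integral) auto
  then show ?thesis using nn_integral_kern[OF assms] by (simp add: measure_def)
qed

text \<open>
  One linear combination of cylinder probabilities approximates the integral of \<open>h\<close> against \<open>\<mu>\<close> and
  against \<open>K\<^sub>n(\<cdot>, y)\<close> for all \<open>y\<close> simultaneously; for such combinations invariance is known.
\<close>

lemma integral_kern_op:
  fixes f :: "(nat \<Rightarrow> 'a::finite) \<Rightarrow> real"
  assumes f: "f \<in> Cont" and \<mu>: "\<mu> \<in> kern_invariant f" and n: "n \<ge> 1" and h: "h \<in> Cont"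
  shows "(\<integral>y. kern_op f n h y \<partial>\<mu>) = (\<integral>x. h x \<partial>\<mu>)"
proof -
  have \<mu>P: "\<mu> \<in> Prob" using \<mu> by (rule kern_invariant_Prob)
  interpret prob_space \<mu> using \<mu>P by (rule Prob_prob_space)
  have "\<bar>(\<integral>y. kern_op f n h y \<partial>\<mu>) - (\<integral>x. h x \<partial>\<mu>)\<bar> \<le> 0 + e" if "e > 0" for e
  proof -
    obtain m where m: "\<And>\<nu>. \<nu> \<in> Prob \<Longrightarrow>
        \<bar>(\<integral>x. h x \<partial>\<nu>) - (\<Sum>w\<in>words m. h w * measure \<nu> {x. agree m w x})\<bar> \<le> e / 2"
      using integral_approx_cylinders[OF h, of "e / 2"] \<open>e > 0\<close> by auto
    define s where "s y = (\<Sum>w\<in>words m. h w * kern f n {x. agree m w x} y)" for y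
    have s: "s \<in> Cont"
      unfolding s_def by (intro Cont_sum Cont_mult Cont_const Cont_kern f cylinder_of_word)
    have "\<bar>kern_op f n h y - s y\<bar> \<le> e / 2" for y
      using m[OF kern_measure_in_Prob[of f n y]]
      by (simp add: s_def integral_kern_measure Cont_borel h measure_kern_measure
          cylinder_borel cylinder_of_word)
    then have "(\<integral>y. \<bar>kern_op f n h y - s y\<bar> \<partial>\<mu>) \<le> e / 2"
      using Cont_integrable[OF Cont_kern_op[OF f h] \<mu>P] Cont_integrable[OF s \<mu>P]
      by (intro integral_le_const) auto
    moreover have "\<bar>\<integral>y. kern_op f n h y - s y \<partial>\<mu>\<bar> \<le> (\<integral>y. \<bar>kern_op f n h y - s y\<bar> \<partial>\<mu>)"
      by (rule integral_abs_bound)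
    moreover have "(\<integral>y. kern_op f n h y - s y \<partial>\<mu>) = (\<integral>y. kern_op f n h y \<partial>\<mu>) - (\<integral>y. s y \<partial>\<mu>)"
      using Cont_integrable[OF Cont_kern_op[OF f h] \<mu>P] Cont_integrable[OF s \<mu>P] by simp
    moreover have "(\<integral>y. s y \<partial>\<mu>) = (\<Sum>w\<in>words m. h w * measure \<mu> {x. agree m w x})"
    proof -
      have "(\<integral>y. s y \<partial>\<mu>) = (\<Sum>w\<in>words m. \<integral>y. h w * kern f n {x. agree m w x} y \<partial>\<mu>)"
        unfolding s_def
        using Cont_integrable[OF Cont_kern[OF f cylinder_of_word] \<mu>P]
        by (intro Bochner_Integration.integral_sum) auto
      then show ?thesis
        by (simp add: integral_kern[OF f \<mu> n cylinder_borel[OF cylinder_of_word]])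
    qed
    ultimately show ?thesis using m[OF \<mu>P] by linarith
  qed
  then have "\<bar>(\<integral>y. kern_op f n h y \<partial>\<mu>) - (\<integral>x. h x \<partial>\<mu>)\<bar> \<le> 0"
    by (rule field_le_epsilon)
  then show ?thesis by simp
qed

lemma G_DLR_eq_kern_invariant:
  fixes f :: "(nat \<Rightarrow> 'a::finite) \<Rightarrow> real"
  assumes f: "f \<in> Cont"
  shows "G_DLR f = kern_invariant f"
proof (intro set_eqI iffI)
  fix \<mu> assume \<mu>: "\<mu> \<in> G_DLR f"
  then have \<mu>P: "\<mu> \<in> Prob" by (simp add: G_DLR_def)
  interpret prob_space \<mu> using \<mu>P by (rule Prob_prob_space)
  have "(\<integral>y. kern f n A y \<partial>\<mu>) = measure \<mu> A" if "n \<ge> 1" and A: "A \<in> cylinder_sets" for n A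
  proof -
    interpret finite_measure_subalgebra \<mu> "tail_algebra n"
      by unfold_locales (rule subalgebra_tail_algebra[OF \<mu>P])
    have A': "A \<in> sets seq_borel" using A by (rule cylinder_borel)
    have "AE y in \<mu>. real_cond_exp \<mu> (tail_algebra n) (indicator A) y = kern f n A y"
      using \<mu> \<open>n \<ge> 1\<close> A' by (simp add: G_DLR_def)
    then have "(\<integral>y. kern f n A y \<partial>\<mu>) = (\<integral>y. real_cond_exp \<mu> (tail_algebra n) (indicator A) y \<partial>\<mu>)"
      using kern_measurable[OF f A' \<mu>P] by (intro integral_cong_AE) auto
    also have "\<dots> = (\<integral>y. indicator A y \<partial>\<mu>)"
      using A' Prob_sets[OF \<mu>P] by (intro real_cond_exp_int) (simp add: emeasure_finite less_top[symmetric])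
    also have "\<dots> = measure \<mu> A" using Prob_space[OF \<mu>P] by simp
    finally show ?thesis .
  qed
  with \<mu>P show "\<mu> \<in> kern_invariant f" by (simp add: kern_invariant_def)
next
  fix \<mu> assume \<mu>: "\<mu> \<in> kern_invariant f"
  then have \<mu>P: "\<mu> \<in> Prob" by (rule kern_invariant_Prob)
  interpret prob_space \<mu> using \<mu>P by (rule Prob_prob_space)
  have "AE y in \<mu>. real_cond_exp \<mu> (tail_algebra n) (indicator F) y = kern f n F y"
    if F: "F \<in> sets seq_borel" and n: "n \<ge> 1" for F n
  proof -
    interpret finite_measure_subalgebra \<mu> "tail_algebra n"
      by unfold_locales (rule subalgebra_tail_algebra[OF \<mu>P])
    have F\<mu>: "F \<in> sets \<mu>" using F Prob_sets[OF \<mu>P] by simp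
    show ?thesis
    proof (rule real_cond_exp_charact)
      fix A :: "(nat \<Rightarrow> 'a) set" assume A: "A \<in> sets (tail_algebra n)"
      then have AF: "A \<inter> F \<in> sets seq_borel" using tail_algebra_borel F by blast
      have "(\<integral>x\<in>A. indicator F x \<partial>\<mu>) = (\<integral>x. (indicator (A \<inter> F) x :: real) \<partial>\<mu>)"
        by (simp add: set_lebesgue_integral_def indicator_inter_arith)
      also have "\<dots> = measure \<mu> (A \<inter> F)" using Prob_space[OF \<mu>P] by simp
      also have "\<dots> = (\<integral>x. kern f n (A \<inter> F) x \<partial>\<mu>)" using integral_kern[OF f \<mu> n AF] by simp
      also have "\<dots> = (\<integral>x\<in>A. kern f n F x \<partial>\<mu>)"
        by (simp add: set_lebesgue_integral_def kern_tail_event[OF A])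
      finally show "(\<integral>x\<in>A. indicator F x \<partial>\<mu>) = (\<integral>x\<in>A. kern f n F x \<partial>\<mu>)" .
    next
      show "integrable \<mu> (indicator F :: _ \<Rightarrow> real)"
        using F\<mu> by (simp add: emeasure_finite less_top[symmetric])
      show "integrable \<mu> (kern f n F)"
        using kern_measurable[OF f F \<mu>P] kern_nonneg[of f n F] kern_le_1[OF F, of f n]
        by (intro integrable_const_bound[of _ 1]) auto
      show "kern f n F \<in> borel_measurable (tail_algebra n)" by (rule kern_measurable_tail[OF f F])
    qed
  qed
  with \<mu>P show "\<mu> \<in> G_DLR f" by (simp add: G_DLR_def)
qed


section \<open>Thermodynamic limits are Gibbs measures\<close>

lemma cluster_points_Prob: "cluster_points f y \<subseteq> Prob"
  by (auto simp: cluster_points_def limitin_def)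

text \<open>
  For \<open>r k \<ge> n\<close> the measure \<open>K\<^bsub>r k\<^esub>(\<cdot>, y)\<close> gives \<open>1\<^sub>A\<close> and \<open>K\<^sub>n 1\<^sub>A\<close> the same integral, by consistency;
  both functions are continuous, so the equality survives the weak-* limit.
\<close>

lemma cluster_points_kern_invariant:
  fixes f :: "(nat \<Rightarrow> 'a::finite) \<Rightarrow> real"
  assumes f: "f \<in> Cont"
  shows "cluster_points f y \<subseteq> kern_invariant f"
proof
  fix \<mu> assume \<mu>: "\<mu> \<in> cluster_points f y"
  then have \<mu>P: "\<mu> \<in> Prob" using cluster_points_Prob by blast
  from \<mu> obtain r where r: "strict_mono r"
      and lim: "limitin weak_star (\<lambda>k. kern_measure f (r k) y) \<mu> sequentially"
    unfolding cluster_points_def by blast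
  have lim_int: "(\<lambda>k. kern_op f (r k) g y) \<longlonglongrightarrow> (\<integral>x. g x \<partial>\<mu>)" if "g \<in> Cont" for g
    using lim that unfolding limitin_weak_star_iff[OF kern_measure_in_Prob]
    by (simp add: integral_kern_measure Cont_borel)
  have "(\<integral>z. kern f n A z \<partial>\<mu>) = measure \<mu> A" if "A \<in> cylinder_sets" for n A
  proof -
    have "\<forall>\<^sub>F k in sequentially. n \<le> r k"
      using eventually_ge_at_top[of n] by (rule eventually_mono) (meson seq_suble[OF r] le_trans)
    then have "\<forall>\<^sub>F k in sequentially. kern_op f (r k) (kern f n A) y = kern_op f (r k) (indicator A) y"
      by (rule eventually_mono) (simp add: kern_eq_kern_op kern_op_consistent)
    then have "(\<lambda>k. kern_op f (r k) (indicator A) y) \<longlonglongrightarrow> (\<integral>z. kern f n A z \<partial>\<mu>)"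
      by (rule Lim_transform_eventually[OF lim_int[OF Cont_kern[OF f that]]])
    with lim_int[OF Cont_indicator_cylinder[OF that]] have
      "(\<integral>z. kern f n A z \<partial>\<mu>) = (\<integral>z. indicator A z \<partial>\<mu>)" by (rule LIMSEQ_unique[rotated])
    then show ?thesis using Prob_space[OF \<mu>P] by simp
  qed
  with \<mu>P show "\<mu> \<in> kern_invariant f" by (simp add: kern_invariant_def)
qed

lemma measure_convex_hull_kern_invariant:
  fixes f :: "(nat \<Rightarrow> 'a::finite) \<Rightarrow> real"
  assumes f: "f \<in> Cont" and S: "S \<subseteq> kern_invariant f"
  shows "measure_convex_hull S \<subseteq> kern_invariant f"
proof
  fix \<mu> assume "\<mu> \<in> measure_convex_hull S"
  then obtain T w where \<mu>: "\<mu> \<in> Prob" and T: "finite T" "T \<subseteq> S"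
    and w: "\<forall>\<nu>\<in>T. 0 \<le> w \<nu>" "(\<Sum>\<nu>\<in>T. w \<nu>) = (1::real)"
    and mix: "\<forall>F \<in> sets seq_borel. measure \<mu> F = (\<Sum>\<nu>\<in>T. w \<nu> * measure \<nu> F)"
    unfolding measure_convex_hull_def by blast
  have TP: "T \<subseteq> Prob" using T(2) S kern_invariant_Prob by blast
  have "(\<integral>y. kern f n A y \<partial>\<mu>) = measure \<mu> A" if "n \<ge> 1" "A \<in> cylinder_sets" for n A
  proof -
    have "(\<integral>y. kern f n A y \<partial>\<mu>) = (\<Sum>\<nu>\<in>T. w \<nu> * (\<integral>y. kern f n A y \<partial>\<nu>))"
      using integral_mixture[OF T(1) TP _ w(2) \<mu> _ Cont_kern[OF f that(2)]] w(1) mix by blast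
    also have "\<dots> = (\<Sum>\<nu>\<in>T. w \<nu> * measure \<nu> A)"
      using T(2) S that unfolding kern_invariant_def by (intro sum.cong) auto
    also have "\<dots> = measure \<mu> A" using mix cylinder_borel[OF that(2)] by simp
    finally show ?thesis .
  qed
  with \<mu> show "\<mu> \<in> kern_invariant f" by (simp add: kern_invariant_def)
qed

lemma closedin_kern_invariant:
  fixes f :: "(nat \<Rightarrow> 'a::finite) \<Rightarrow> real"
  assumes f: "f \<in> Cont"
  shows "closedin weak_star (kern_invariant f)"
proof -
  define D where "D p = {\<mu> \<in> Prob. (\<integral>y. kern f (fst p) (snd p) y - indicator (snd p) y \<partial>\<mu>) \<in> {0}}"
    for p
  have "closedin weak_star (D p)" if p: "p \<in> {1..} \<times> cylinder_sets" for p
  proof -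
    have "(\<lambda>y. kern f (fst p) (snd p) y - indicator (snd p) y) \<in> Cont"
      using p by (intro Cont_diff Cont_kern f Cont_indicator_cylinder) auto
    then have "openin weak_star {\<mu> \<in> Prob.
        (\<integral>y. kern f (fst p) (snd p) y - indicator (snd p) y \<partial>\<mu>) \<in> - {0}}"
      by (rule openin_weak_star_integral) (simp add: open_Compl)
    moreover have "topspace weak_star - D p = {\<mu> \<in> Prob.
        (\<integral>y. kern f (fst p) (snd p) y - indicator (snd p) y \<partial>\<mu>) \<in> - {0}}"
      by (auto simp: D_def)
    ultimately show ?thesis by (simp add: closedin_def D_def)
  qed
  then have "closedin weak_star (\<Inter>p\<in>{1..} \<times> cylinder_sets. D p)"
    using UNIV_cylinder by (intro closedin_INT) auto
  moreover have "(\<integral>y. kern f n A y - indicator A y \<partial>\<mu>) = (\<integral>y. kern f n A y \<partial>\<mu>) - measure \<mu> A"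
    if "\<mu> \<in> Prob" "A \<in> cylinder_sets" for n A \<mu>
    using that Cont_integrable[OF Cont_kern[OF f] that(1)]
      Cont_integrable[OF Cont_indicator_cylinder that(1)] Prob_space[OF that(1)] by simp
  then have "(\<Inter>p\<in>{1..} \<times> cylinder_sets. D p) = kern_invariant f"
    using UNIV_cylinder unfolding D_def kern_invariant_def by fastforce
  ultimately show ?thesis by simp
qed


section \<open>Gibbs measures are thermodynamic limits\<close>

text \<open>
  No continuous function separates an invariant measure from the cluster points.  If every cluster
  point gave \<open>h\<close> an integral below \<open>c = \<integral>h d\<mu> - \<eta>\<close>, then by compactness \<open>K\<^sub>n h\<close> would
  eventually be at most \<open>c\<close> at each boundary condition, so the positive parts of \<open>K\<^sub>n h - c\<close> would
  tend to \<open>0\<close> pointwise and boundedly; but their \<open>\<mu>\<close>-integrals are at least \<open>\<eta>\<close> by invariance.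
\<close>

lemma ex_cluster_point_integral_ge:
  fixes f :: "(nat \<Rightarrow> 'a::finite) \<Rightarrow> real"
  assumes f: "f \<in> Cont" and \<mu>: "\<mu> \<in> kern_invariant f" and h: "h \<in> Cont" and \<eta>: "\<eta> > 0"
  shows "\<exists>\<rho>\<in>(\<Union>y. cluster_points f y). (\<integral>x. h x \<partial>\<mu>) - \<eta> \<le> (\<integral>x. h x \<partial>\<rho>)"
proof (rule ccontr)
  define c where "c = (\<integral>x. h x \<partial>\<mu>) - \<eta>"
  assume "\<not> ?thesis"
  then have below: "(\<integral>x. h x \<partial>\<rho>) < c" if "\<rho> \<in> cluster_points f y" for \<rho> y
    using that unfolding c_def by (meson UN_I UNIV_I not_le)
  have \<mu>P: "\<mu> \<in> Prob" using \<mu> by (rule kern_invariant_Prob)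
  interpret prob_space \<mu> using \<mu>P by (rule Prob_prob_space)
  have ev: "\<forall>\<^sub>F n in sequentially. kern_op f n h y \<le> c" for y
  proof (rule ccontr)
    assume not_ev: "\<not> (\<forall>\<^sub>F n in sequentially. kern_op f n h y \<le> c)"
    \<comment> \<open>Along the exceptional times, which are taken to be at least \<open>1\<close> as cluster points require,
      a weak-* limit of the kernels gives \<open>h\<close> an integral of at least \<open>c\<close>.\<close>
    define N where "N = {n. 1 \<le> n \<and> c < kern_op f n h y}"
    have "infinite N"
      unfolding infinite_nat_iff_unbounded_le
    proof
      fix m
      obtain n where "n \<ge> max m 1" "\<not> kern_op f n h y \<le> c"
        using not_ev unfolding eventually_sequentially by blast
      then show "\<exists>n\<ge>m. n \<in> N" by (auto simp: N_def)
    qed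
    then have s: "strict_mono (enumerate N)" "\<And>k. enumerate N k \<in> N"
      by (auto simp: strict_mono_enumerate enumerate_in_set)
    obtain d \<rho> where d: "strict_mono d"
        "limitin weak_star (\<lambda>k. kern_measure f (enumerate N (d k)) y) \<rho> sequentially"
      using Prob_weak_star_seq_compact[of "\<lambda>k. kern_measure f (enumerate N k) y"]
        kern_measure_in_Prob by blast
    have "\<rho> \<in> cluster_points f y"
      unfolding cluster_points_def
    proof (intro CollectI exI conjI allI)
      show "strict_mono (\<lambda>k. enumerate N (d k))"
        using strict_mono_o[OF s(1) d(1)] by (simp add: o_def)
      show "1 \<le> enumerate N (d k)" for k using s(2)[of "d k"] by (simp add: N_def)
    qed (rule d(2))
    moreover have "(\<lambda>k. kern_op f (enumerate N (d k)) h y) \<longlonglongrightarrow> (\<integral>x. h x \<partial>\<rho>)"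
      using d(2) h unfolding limitin_weak_star_iff[OF kern_measure_in_Prob]
      by (simp add: integral_kern_measure Cont_borel)
    then have "c \<le> (\<integral>x. h x \<partial>\<rho>)"
    proof (rule LIMSEQ_le_const)
      show "\<exists>M. \<forall>k\<ge>M. c \<le> kern_op f (enumerate N (d k)) h y"
        using s(2) by (auto simp: N_def less_imp_le)
    qed
    ultimately show False using below by fastforce
  qed
  obtain B where B: "\<And>x. \<bar>h x\<bar> \<le> B" using bounded_Cont[OF h] by blast
  have K_int: "integrable \<mu> (kern_op f n h)" for n
    by (rule Cont_integrable[OF Cont_kern_op[OF f h] \<mu>P])
  define u where "u n y = max (kern_op f n h y - c) 0" for n y
  have u_meas: "u n \<in> borel_measurable \<mu>" for n
    using Cont_measurable[OF Cont_kern_op[OF f h] \<mu>P] unfolding u_def by measurable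
  have u_bound: "norm (u n y) \<le> B + \<bar>c\<bar>" for n y
    using abs_kern_op_le[where h = h and B = B and f = f and n = n and y = y] B by (auto simp: u_def)
  have "(\<lambda>n. \<integral>y. u n y \<partial>\<mu>) \<longlonglongrightarrow> (\<integral>y. 0 \<partial>\<mu>)"
  proof (rule integral_dominated_convergence[where w = "\<lambda>_. B + \<bar>c\<bar>"])
    show "AE y in \<mu>. (\<lambda>n. u n y) \<longlonglongrightarrow> 0"
    proof (rule AE_I2)
      fix y
      have "\<forall>\<^sub>F n in sequentially. u n y = 0"
        using ev[of y] by (rule eventually_mono) (simp add: u_def)
      then show "(\<lambda>n. u n y) \<longlonglongrightarrow> 0" by (rule tendsto_eventually)
    qed
  qed (use u_meas u_bound in auto)
  moreover have "\<eta> \<le> (\<integral>y. u n y \<partial>\<mu>)" if "n \<ge> 1" for n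
  proof -
    have "\<eta> = (\<integral>y. kern_op f n h y - c \<partial>\<mu>)"
      using K_int[of n] integral_kern_op[OF f \<mu> that h] by (simp add: c_def prob_space)
    also have "\<dots> \<le> (\<integral>y. u n y \<partial>\<mu>)"
    proof (rule integral_mono)
      show "integrable \<mu> (u n)"
        by (rule integrable_const_bound[of _ "B + \<bar>c\<bar>"]) (use u_meas u_bound in auto)
    qed (use K_int in \<open>auto simp: u_def\<close>)
    finally show ?thesis .
  qed
  ultimately have "\<eta> \<le> 0" by (intro LIMSEQ_le_const) auto
  with \<eta> show False by simp
qed

theorem theorem1:
  fixes f :: "(nat \<Rightarrow> 'a::finite) \<Rightarrow> real"
  assumes "f \<in> Cont"
  shows "G_DLR f = G_TL f"
proof
  let ?S = "\<Union>y. cluster_points f y"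
  have S: "?S \<subseteq> kern_invariant f" using cluster_points_kern_invariant[OF assms] by blast
  show "G_TL f \<subseteq> G_DLR f"
    unfolding G_TL_def G_DLR_eq_kern_invariant[OF assms]
    using measure_convex_hull_kern_invariant[OF assms S] closedin_kern_invariant[OF assms]
    by (rule closure_of_minimal)
  show "G_DLR f \<subseteq> G_TL f"
    unfolding G_TL_def G_DLR_eq_kern_invariant[OF assms]
  proof
    fix \<mu> assume \<mu>: "\<mu> \<in> kern_invariant f"
    then have \<mu>P: "\<mu> \<in> Prob" by (rule kern_invariant_Prob)
    have "\<exists>\<nu>\<in>measure_convex_hull ?S. \<nu> \<in> U" if U: "\<mu> \<in> U" "openin weak_star U" for U
    proof -
      from weak_star_nbhd[OF U(2,1)] obtain G e where G: "finite G" "G \<subseteq> Cont" "e > 0"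
        "\<forall>\<nu>\<in>Prob. (\<forall>g\<in>G. \<bar>(\<integral>x. g x \<partial>\<nu>) - (\<integral>x. g x \<partial>\<mu>)\<bar> < e) \<longrightarrow> \<nu> \<in> U"
        by (elim exE conjE)
      have "\<forall>g\<in>Cont. \<exists>B. \<forall>\<nu>\<in>Prob. \<bar>\<integral>x. (g :: (nat \<Rightarrow> 'a) \<Rightarrow> real) x \<partial>\<nu>\<bar> \<le> B"
        using abs_integral_Cont_le by blast
      from bchoice[OF this] obtain B :: "((nat \<Rightarrow> 'a) \<Rightarrow> real) \<Rightarrow> real"
        where B: "\<forall>g\<in>Cont. \<forall>\<nu>\<in>Prob. \<bar>\<integral>x. g x \<partial>\<nu>\<bar> \<le> B g" by blast
      have SP: "?S \<subseteq> Prob" using cluster_points_Prob by blast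
      obtain T w where T: "finite T" "T \<subseteq> ?S" "\<And>\<nu>. \<nu> \<in> T \<Longrightarrow> 0 \<le> w \<nu>" "(\<Sum>\<nu>\<in>T. w \<nu>) = (1::real)"
        and close: "\<And>g. g \<in> G \<Longrightarrow> \<bar>(\<Sum>\<nu>\<in>T. w \<nu> * (\<integral>x. g x \<partial>\<nu>)) - (\<integral>x. g x \<partial>\<mu>)\<bar> < e"
        \<comment> \<open>The coordinates of a measure are its integrals against the functions in \<open>G\<close>.\<close>
      proof (rule convex_combination_approx[of G ?S "\<lambda>g \<nu>. \<integral>x. g x \<partial>\<nu>" B "\<lambda>g. \<integral>x. g x \<partial>\<mu>" e])
        show "\<bar>\<integral>x. g x \<partial>\<nu>\<bar> \<le> B g" if "g \<in> G" "\<nu> \<in> ?S" for g \<nu>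
          using that G(2) SP B by blast
        show "\<exists>\<nu>\<in>?S. (\<Sum>g\<in>G. a g * (\<integral>x. g x \<partial>\<mu>)) - \<eta> \<le> (\<Sum>g\<in>G. a g * (\<integral>x. g x \<partial>\<nu>))"
          if "\<eta> > 0" for a and \<eta> :: real
        proof -
          define h where "h x = (\<Sum>g\<in>G. a g * g x)" for x
          have h: "h \<in> Cont"
            unfolding h_def using G(2) by (intro Cont_sum Cont_mult Cont_const) auto
          have int_h: "(\<integral>x. h x \<partial>\<nu>) = (\<Sum>g\<in>G. a g * (\<integral>x. g x \<partial>\<nu>))" if "\<nu> \<in> Prob" for \<nu>
          proof -
            have "integrable \<nu> (\<lambda>x. a g * g x)" if "g \<in> G" for g
              using Cont_integrable[of g \<nu>] G(2) \<open>\<nu> \<in> Prob\<close> that by auto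
            then show ?thesis unfolding h_def by (subst Bochner_Integration.integral_sum) auto
          qed
          obtain \<rho> where \<rho>: "\<rho> \<in> ?S" "(\<integral>x. h x \<partial>\<mu>) - \<eta> \<le> (\<integral>x. h x \<partial>\<rho>)"
            using ex_cluster_point_integral_ge[OF assms \<mu> h \<open>\<eta> > 0\<close>] by blast
          have "\<rho> \<in> Prob" using SP \<rho>(1) by (rule subsetD)
          with \<rho>(2) int_h \<mu>P
          have "(\<Sum>g\<in>G. a g * (\<integral>x. g x \<partial>\<mu>)) - \<eta> \<le> (\<Sum>g\<in>G. a g * (\<integral>x. g x \<partial>\<rho>))" by auto
          with \<rho>(1) show ?thesis by (rule bexI[rotated])
        qed
      qed (use G in auto)
      have TP: "T \<subseteq> Prob" using T(2) SP by blast
      obtain \<nu> where \<nu>: "\<nu> \<in> Prob"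
          "\<And>F. F \<in> sets seq_borel \<Longrightarrow> measure \<nu> F = (\<Sum>\<rho>\<in>T. w \<rho> * measure \<rho> F)"
        using Prob_mixture[OF T(1) TP T(3,4)] by blast
      have "\<nu> \<in> measure_convex_hull ?S"
        unfolding measure_convex_hull_def using \<nu> T by blast
      moreover have "\<nu> \<in> U"
      proof -
        have "\<bar>(\<integral>x. g x \<partial>\<nu>) - (\<integral>x. g x \<partial>\<mu>)\<bar> < e" if "g \<in> G" for g
        proof -
          have "g \<in> Cont" using that G(2) by blast
          from integral_mixture[OF T(1) TP T(3,4) \<nu> this] show ?thesis using close[OF that] by simp
        qed
        then show ?thesis using G(4) \<nu>(1) by blast
      qed
      ultimately show ?thesis by blast
    qed
    then show "\<mu> \<in> weak_star closure_of measure_convex_hull ?S"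
      unfolding in_closure_of topspace_weak_star using \<mu>P by blast
  qed
qed

end
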